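(* Let $0<q<1$, $a<0$, $n\ge2$, $\alpha\in\mathbb R\setminus[a,1]$. For $N\ge0$ let $\eta_{n,1}\le\dots\le\eta_{n,n}$ be the zeros of the Al-Salam-Carlitz I-Sobolev-type polynomial $U_n^{(a,\alpha)}(N;x;q)$. (i) If $\alpha<a$, put $$N_0=\left(\frac{[n]_qU_{n-1}^{(a)}(\alpha;q)}{U_n^{(a)}(a;q)}\mathscr K_{q,n}^{(0,1)}(a,\alpha)-\mathscr K_{q,n}^{(1,1)}(\alpha,\alpha)\right)^{-1}.$$ Then $N_0>0$, and the smallest zero satisfies $\eta_{n,1}>a$ for $N<N_0$, $\eta_{n,1}=a$ for $N=N_0$, and $\eta_{n,1}<a$ for $N>N_0$. (ii) If $\alpha>1$, put $$N_0=\left(\frac{[n]_qU_{n-1}^{(a)}(\alpha;q)}{U_n^{(a)}(1;q)}\mathscr K_{q,n}^{(0,1)}(1,\alpha)-\mathscr K_{q,n}^{(1,1)}(\alpha,\alpha)\right)^{-1}.$$ Then $N_0>0$, and the largest zero satisfies $\eta_{n,n}<1$ for $N<N_0$, $\eta_{n,n}=1$ for $N=N_0$, and $\eta_{n,n}>1$ for $N>N_0$.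
   Context: $[n]_q=\frac{1-q^n}{1-q}$; $(b;q)_k=\prod_{j=0}^{k-1}(1-bq^j)$, $(b_1,b_2;q)_\infty=\prod_{j\ge0}(1-b_1q^j)(1-b_2q^j)$. $(\mathscr D_qf)(x)=\frac{f(qx)-f(x)}{(q-1)x}$ for $x\ne0$, $(\mathscr D_qf)(0)=f'(0)$. For $a<0$, $\int_a^1f(x)\,d_qx=(1-q)\sum_{k\ge0}f(q^k)q^k-a(1-q)\sum_{k\ge0}f(aq^k)q^k$. $U_n^{(a)}(x;q)$ ($n\ge0$) are the monic Al-Salam-Carlitz I polynomials, $U_n^{(a)}(x;q)=(-a)^nq^{\binom n2}\sum_{k=0}^n\frac{(q^{-n};q)_k(x^{-1};q)_k}{(q;q)_k}(a^{-1}qx)^k$, which are the monic orthogonal polynomials for $\langle{\bf u},f\rangle=\int_a^1f(x)(qx,a^{-1}qx;q)_\infty d_qx$; write $\|U_n^{(a)}\|^2=\langle{\bf u},(U_n^{(a)})^2\rangle$. $U_n^{(a,\alpha)}(N;x;q)$ is the monic polynomial of degree $n$ orthogonal to all polynomials of degree $<n$ with respect to $\langle f,g\rangle_S=\langle{\bf u},fg\rangle+N(\mathscr D_qf)(\alpha)(\mathscr D_qg)(\alpha)$; its zeros are real. Kernels: $\mathscr K_{q,n}^{(i,j)}(x,y)=\sum_{k=0}^{n-1}\frac{(\mathscr D_q^iU_k^{(a)})(x;q)(\mathscr D_q^jU_k^{(a)})(y;q)}{\|U_k^{(a)}\|^2}$. *)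

theory Defs
  imports "HOL-Analysis.Analysis" "HOL-Computational_Algebra.Computational_Algebra"
begin

definition q_number :: "real \<Rightarrow> nat \<Rightarrow> real" where
  "q_number q n = (1 - q ^ n) / (1 - q)"

definition qpoch :: "real \<Rightarrow> real \<Rightarrow> nat \<Rightarrow> real" where
  "qpoch b q k = (\<Prod>j<k. 1 - b * q ^ j)"

definition qpoch_inf2 :: "real \<Rightarrow> real \<Rightarrow> real \<Rightarrow> real" where
  "qpoch_inf2 b c q = (\<Prod>j. (1 - b * q ^ j) * (1 - c * q ^ j))"

definition q_diff :: "real \<Rightarrow> (real \<Rightarrow> real) \<Rightarrow> real \<Rightarrow> real" where
  "q_diff q f x = (if x = 0 then deriv f 0 else (f (q * x) - f x) / ((q - 1) * x))"

definition q_integral :: "real \<Rightarrow> real \<Rightarrow> (real \<Rightarrow> real) \<Rightarrow> real" where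
  "q_integral a q f =
     (1 - q) * (\<Sum>k. f (q ^ k) * q ^ k) - a * (1 - q) * (\<Sum>k. f (a * q ^ k) * q ^ k)"

text \<open>
  The factor \<open>(1/x; q)_k x ^ k\<close> of the usual hypergeometric formula is entered as the polynomial
  \<open>\<Prod>j<k. (x - q ^ j)\<close>, so that the value at \<open>x = 0\<close> is the right one (division by zero would
  give \<open>0\<close> there). Lemma \<open>poly_ASC_U\<close> below gives the usual formula for \<open>x \<noteq> 0\<close>.
\<close>

definition ASC_U :: "real \<Rightarrow> real \<Rightarrow> nat \<Rightarrow> real poly" where
  "ASC_U a q n = smult ((- a) ^ n * q ^ (n choose 2))
     (\<Sum>k\<le>n. smult (qpoch (q powi (- int n)) q k / qpoch q q k * (inverse a * q) ^ k)
               (\<Prod>j<k. [:- (q ^ j), 1:]))"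

lemma poly_ASC_U:
  assumes "x \<noteq> 0"
  shows "poly (ASC_U a q n) x = (- a) ^ n * q ^ (n choose 2) *
    (\<Sum>k\<le>n. qpoch (q powi (- int n)) q k * qpoch (inverse x) q k / qpoch q q k
              * (inverse a * q * x) ^ k)"
proof -
  have "(\<Prod>j<k. x - q ^ j) = qpoch (inverse x) q k * x ^ k" for k
    using assms
    by (induction k) (simp_all add: qpoch_def field_simps)
  then show ?thesis
    by (simp add: ASC_U_def poly_sum poly_prod power_mult_distrib mult_ac)
qed

definition ASC_functional :: "real \<Rightarrow> real \<Rightarrow> (real \<Rightarrow> real) \<Rightarrow> real" where
  "ASC_functional a q f = q_integral a q (\<lambda>x. f x * qpoch_inf2 (q * x) (inverse a * q * x) q)"

definition ASC_norm2 :: "real \<Rightarrow> real \<Rightarrow> nat \<Rightarrow> real" where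
  "ASC_norm2 a q n = ASC_functional a q (\<lambda>x. (poly (ASC_U a q n) x)\<^sup>2)"

definition ASC_kernel :: "real \<Rightarrow> real \<Rightarrow> nat \<Rightarrow> nat \<Rightarrow> nat \<Rightarrow> real \<Rightarrow> real \<Rightarrow> real" where
  "ASC_kernel a q n i j x y =
     (\<Sum>k<n. (q_diff q ^^ i) (poly (ASC_U a q k)) x * (q_diff q ^^ j) (poly (ASC_U a q k)) y
             / ASC_norm2 a q k)"

definition sobolev_inner ::
  "real \<Rightarrow> real \<Rightarrow> real \<Rightarrow> real \<Rightarrow> (real \<Rightarrow> real) \<Rightarrow> (real \<Rightarrow> real) \<Rightarrow> real" where
  "sobolev_inner a q \<alpha> N f g =
     ASC_functional a q (\<lambda>x. f x * g x) + N * q_diff q f \<alpha> * q_diff q g \<alpha>"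

definition sobolev_U :: "real \<Rightarrow> real \<Rightarrow> real \<Rightarrow> real \<Rightarrow> nat \<Rightarrow> real poly" where
  "sobolev_U a q \<alpha> N n =
     (THE P. degree P = n \<and> lead_coeff P = 1 \<and>
             (\<forall>p. degree p < n \<longrightarrow> sobolev_inner a q \<alpha> N (poly P) (poly p) = 0))"

text \<open>
  The \<open>i\<close>-th smallest zero, counted with multiplicity, for \<open>1 \<le> i \<le> n\<close>. All zeros are real, so
  the list of real zeros has length \<open>n\<close>.
\<close>

definition sobolev_zero :: "real \<Rightarrow> real \<Rightarrow> real \<Rightarrow> real \<Rightarrow> nat \<Rightarrow> nat \<Rightarrow> real" where
  "sobolev_zero a q \<alpha> N n i =
     sorted_list_of_multiset (proots (sobolev_U a q \<alpha> N n)) ! (i - 1)"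

text \<open>
  The critical mass for an endpoint \<open>e\<close> of the interval \<open>[a, 1]\<close>.
\<close>

definition critical_mass :: "real \<Rightarrow> real \<Rightarrow> real \<Rightarrow> nat \<Rightarrow> real \<Rightarrow> real" where
  "critical_mass a q \<alpha> n e =
     inverse (q_number q n * poly (ASC_U a q (n - 1)) \<alpha> / poly (ASC_U a q n) e
                * ASC_kernel a q n 0 1 e \<alpha>
              - ASC_kernel a q n 1 1 \<alpha> \<alpha>)"

end

theory Submission
  imports Defs
begin

text \<open>
  The zeros of the Sobolev-type polynomial \<open>S\<close> are compared with those of the Al-Salam-Carlitz
  polynomial \<open>U\<^sub>n\<close>. Let \<open>u\<close> be the functional of orthogonality, \<open>L\<close> the \<open>q\<close>-derivative at \<open>\<alpha>\<close> and
  \<open>e\<close> the end of \<open>[a, 1]\<close> near \<open>\<alpha>\<close>. With the kernel polynomial \<open>K\<close> representing \<open>L\<close> on lower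
  degrees, \<open>S = U\<^sub>n - N * L U\<^sub>n / (1 + N * L K) * K\<close>. Dividing by \<open>U\<^sub>n\<close> at \<open>e\<close> gives
  \<open>(1 - N / N\<^sub>0) / (1 + N * L K)\<close> with \<open>N\<^sub>0\<close> the critical mass, so it is enough to show that
  \<open>N\<^sub>0 > 0\<close> and that the sign of this quotient decides on which side of \<open>e\<close> the extreme zero lies.

  Positivity of \<open>N\<^sub>0\<close>. The reciprocal of \<open>N\<^sub>0\<close> is a sum with nonnegative weights of
  \<open>s\<^sub>k * (s\<^sub>n - s\<^sub>k)\<close> over \<open>k < n\<close>, where \<open>s\<^sub>k = L U\<^sub>k / U\<^sub>k e\<close>. By the lowering relation
  \<open>L U\<^sub>k = [k]\<^sub>q * U\<^sub>k\<^sub>-\<^sub>1 \<alpha>\<close>, and the ratios \<open>U\<^sub>k \<alpha> / U\<^sub>k e\<close> increase with \<open>k\<close> by the three-term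
  recurrence. So the \<open>e * s\<^sub>k\<close> start from \<open>0\<close> and increase strictly (\<open>slope_strictly_increasing\<close>,
  \<open>critical_inverse_pos\<close>).

  Location of the zeros. Let \<open>x\<close> be a zero of \<open>U\<^sub>n\<close> and \<open>g = U\<^sub>n / (X - x)\<close>. Testing the
  orthogonality of \<open>S\<close> with \<open>g\<close> gives
  \<open>S x / g x * u (g\<^sup>2) = - N * L S * L g\<close> (\<open>sobolev_poly_at_zero_of_U\<close>). For \<open>N > 0\<close> the product
  \<open>e * L S * L g\<close> is positive for every \<open>x\<close>, so the signs of \<open>S\<close> at the zeros of \<open>U\<^sub>n\<close> alternate,
  and there is one further zero beyond the last of them in the direction of \<open>e\<close>. Hence \<open>S\<close> has
  \<open>n\<close> simple real zeros, and only one of them can reach or cross \<open>e\<close>; the sign of \<open>S e / U\<^sub>n e\<close>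
  then decides (\<open>zeros_of_interlaced_directed\<close>).

  The delicate point is the sign of \<open>L g\<close>, a divided difference between \<open>\<alpha>\<close> and \<open>q * \<alpha>\<close>, because
  \<open>q * \<alpha>\<close> may fall inside the interval. But the measure is discrete with no mass strictly between
  \<open>q * e\<close> and \<open>e\<close>, so \<open>U\<^sub>n\<close> has at most one zero there (\<open>zeros_separated\<close>), and that is enough
  (\<open>cofactor_increment\<close>).

  Orthogonality of the explicitly given polynomials is obtained from the three-term recurrence
  and the Pearson equation of the weight (\<open>pearson\<close>, \<open>asc_u_orthogonal\<close>).
\<close>

section \<open>Real polynomials with real zeros\<close>

lemma prod_linear_factors_dvd:
  fixes p :: "real poly"
  assumes "finite X" "\<And>x. x \<in> X \<Longrightarrow> poly p x = 0"
  shows "(\<Prod>x\<in>X. [:- x, 1:]) dvd p"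
  using assms
proof (induction X rule: finite_induct)
  case (insert x X)
  then obtain r where r: "p = (\<Prod>x\<in>X. [:- x, 1:]) * r" by (auto elim: dvdE)
  have "(\<Prod>z\<in>X. x - z) \<noteq> 0" using insert.hyps by auto
  then have "poly r x = 0"
    using insert.prems[of x] by (simp add: r poly_prod)
  then have "[:- x, 1:] dvd r" by (simp add: poly_eq_0_iff_dvd)
  then have "(\<Prod>z\<in>X. [:- z, 1:]) * [:- x, 1:] dvd p" unfolding r by (rule mult_dvd_mono[OF dvd_refl])
  then show ?case by (simp only: prod.insert[OF insert.hyps] mult.commute)
qed simp

lemma degree_prod_linear_factors: "degree (\<Prod>x\<in>X. [:- x, 1::real:]) = card X"
  by (subst degree_prod_eq_sum_degree) auto

lemma monic_eq_prod_linear_factors: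
  fixes p :: "real poly"
  assumes "finite X" "\<And>x. x \<in> X \<Longrightarrow> poly p x = 0" "degree p = card X" "lead_coeff p = 1"
  shows "p = (\<Prod>x\<in>X. [:- x, 1:])"
proof -
  obtain r where r: "p = (\<Prod>x\<in>X. [:- x, 1:]) * r"
    using prod_linear_factors_dvd[OF assms(1,2)] by (auto elim: dvdE)
  have "p \<noteq> 0" using assms(4) by auto
  then have "r \<noteq> 0" using r by auto
  have "degree p = card X + degree r"
    using \<open>p \<noteq> 0\<close> unfolding r by (subst degree_mult_eq) (auto simp: degree_prod_linear_factors simp del: mult_eq_0_iff prod_zero_iff)
  then have "degree r = 0" using assms(3) by simp
  then obtain c where c: "r = [:c:]" by (rule degree_eq_zeroE)
  have "lead_coeff (\<Prod>x\<in>X. [:- x, 1:]) = 1" by (simp only: lead_coeff_prod) simp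
  then have "lead_coeff p = c" unfolding r lead_coeff_mult c by simp
  with assms(4) have "c = 1" by (simp only:)
  then show ?thesis using r c by simp
qed

lemma poly_no_root_same_sign:
  fixes p :: "real poly"
  assumes "\<And>x. poly p x \<noteq> 0"
  shows "(\<forall>x. poly p x > 0) \<or> (\<forall>x. poly p x < 0)"
proof (rule ccontr)
  assume "\<not> ?thesis"
  then obtain x y where xy: "poly p x < 0" "poly p y > 0"
    using assms by (meson linorder_neqE_linordered_idom)
  then have "x \<noteq> y" by auto
  then consider "x < y" | "y < x" by linarith
  then show False
    using poly_IVT_pos[of x y p] poly_IVT_neg[of y x p] xy assms by cases blast+
qed

text \<open>
  The sign hypothesis says that \<open>S x\<close> has the sign opposite to the derivative at \<open>x\<close> of the monic
  polynomial with zero set \<open>X\<close>. These signs alternate along \<open>X\<close>, so \<open>S\<close> has a zero in each gap; at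
  the last point of \<open>X\<close> it is negative, so there is one more zero to the right. That is \<open>card X\<close> zeros,
  hence all of them. As only one of them lies to the right of \<open>X\<close>, the sign of \<open>S c\<close>
  tells on which side of \<open>c\<close> it is.
\<close>

lemma zeros_of_interlaced:
  fixes S :: "real poly"
  assumes X: "finite X" "X \<noteq> {}"
    and S: "degree S = card X" "lead_coeff S > 0"
    and sign: "\<And>x. x \<in> X \<Longrightarrow> poly S x * (\<Prod>z\<in>X - {x}. x - z) < 0"
    and c: "\<And>x. x \<in> X \<Longrightarrow> x < c"
  shows "card {x. poly S x = 0} = card X"
    and "\<exists>y. poly S y = 0 \<and> (\<forall>z. poly S z = 0 \<longrightarrow> z \<le> y) \<and> sgn (c - y) = sgn (poly S c)"
proof -
  define M where "M = Max X"
  have M: "M \<in> X" "\<And>x. x \<in> X \<Longrightarrow> x \<le> M" using X by (auto simp: M_def)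
  have "(\<Prod>z\<in>X - {M}. M - z) > 0"
    by (rule prod_pos) (use M in \<open>force simp: less_le\<close>)
  then have SM: "poly S M < 0" using sign[OF M(1)] by (simp add: mult_less_0_iff)
  define succ where "succ x = Min {z \<in> X. x < z}" for x
  have succ: "succ x \<in> X" "x < succ x" "\<And>z. z \<in> X \<Longrightarrow> x < z \<Longrightarrow> succ x \<le> z" if "x \<in> X - {M}" for x
  proof -
    have "{z \<in> X. x < z} \<noteq> {}" using that M by (force simp: less_le)
    from Min_in[OF _ this] X show "succ x \<in> X" "x < succ x" by (auto simp: succ_def)
    show "succ x \<le> z" if "z \<in> X" "x < z" for z
      unfolding succ_def using that X by (intro Min_le) auto
  qed
  have ex: "\<exists>y. x < y \<and> y < succ x \<and> poly S y = 0" if x: "x \<in> X - {M}" for x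
  proof -
    define y where "y = succ x"
    have y: "y \<in> X" "x < y" "\<And>z. z \<in> X \<Longrightarrow> x < z \<Longrightarrow> y \<le> z" using succ[OF x] by (auto simp: y_def)
    define Z where "Z = X - {x, y}"
    have Z: "X - {x} = insert y Z" "X - {y} = insert x Z" "finite Z" "x \<notin> Z" "y \<notin> Z"
      using x y X by (auto simp: Z_def)
    have "(\<Prod>z\<in>X - {x}. x - z) = (x - y) * (\<Prod>z\<in>Z. x - z)"
        "(\<Prod>z\<in>X - {y}. y - z) = (y - x) * (\<Prod>z\<in>Z. y - z)"
      unfolding Z(1,2) using Z(3-5) by simp_all
    moreover have "(s * ((x - y) * p)) * (t * ((y - x) * r)) = - (y - x)\<^sup>2 * (s * t) * (p * r)"
      for s t p r :: real by (simp add: power2_eq_square algebra_simps)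
    ultimately have "(poly S x * (\<Prod>z\<in>X - {x}. x - z)) * (poly S y * (\<Prod>z\<in>X - {y}. y - z))
        = - (y - x)\<^sup>2 * (poly S x * poly S y) * (\<Prod>z\<in>Z. (x - z) * (y - z))"
      by (simp only: prod.distrib)
    moreover have "(\<Prod>z\<in>Z. (x - z) * (y - z)) > 0"
    proof (rule prod_pos)
      fix z assume "z \<in> Z"
      then have "z < x \<or> y < z" using y(3)[of z] by (force simp: Z_def)
      then show "(x - z) * (y - z) > 0" using y(2) by (auto simp: zero_less_mult_iff)
    qed
    moreover have "0 < (poly S x * (\<Prod>z\<in>X - {x}. x - z)) * (poly S y * (\<Prod>z\<in>X - {y}. y - z))"
      using sign[of x] sign[of y] x y by (intro mult_neg_neg) auto
    ultimately have "- (y - x)\<^sup>2 * (poly S x * poly S y) > 0"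
      by (simp only: zero_less_mult_pos2)
    then have "poly S x * poly S y < 0" using y(2) by (simp add: mult_less_0_iff zero_less_mult_iff)
    from poly_IVT[OF y(2) this] show ?thesis by (auto simp: y_def)
  qed
  then obtain \<rho> where \<rho>: "\<And>x. x \<in> X - {M} \<Longrightarrow> x < \<rho> x \<and> \<rho> x < succ x \<and> poly S (\<rho> x) = 0"
    by metis
  have inj: "inj_on \<rho> (X - {M})"
  proof (rule linorder_inj_onI')
    fix x y assume "x \<in> X - {M}" "y \<in> X - {M}" "x < y"
    then show "\<rho> x \<noteq> \<rho> y" using \<rho>[of x] \<rho>[of y] succ(3)[of x y] by force
  qed
  have \<rho>M: "\<rho> x < M" if "x \<in> X - {M}" for x
    using \<rho>[OF that] succ[OF that] M(2)[of "succ x"] by force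
  have "S \<noteq> 0" using S by auto
  have fin: "finite {x. poly S x = 0}" using poly_roots_finite[OF \<open>S \<noteq> 0\<close>] .
  have le: "card {x. poly S x = 0} \<le> card X"
    using card_poly_roots_bound[OF \<open>S \<noteq> 0\<close>] S by simp
  \<comment> \<open>The zeros between the points of \<open>X\<close> and one zero to the right of them are all there is.\<close>
  have all: "{x. poly S x = 0} = insert y (\<rho> ` (X - {M}))" if y: "M < y" "poly S y = 0" for y
  proof -
    have "insert y (\<rho> ` (X - {M})) \<subseteq> {x. poly S x = 0}" using y \<rho> by auto
    moreover have "y \<notin> \<rho> ` (X - {M})" using \<rho>M y by force
    then have "card (insert y (\<rho> ` (X - {M}))) = card X"
      using X M(1) by (simp add: card_image[OF inj] card_gt_0_iff Suc_diff_Suc)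
    ultimately show ?thesis using card_subset_eq[OF fin] le card_mono[OF fin] by (metis le_antisym)
  qed
  obtain b where b: "\<forall>x\<ge>b. poly S x \<ge> lead_coeff S"
    using poly_pinfty_gt_lc[OF S(2)] by auto
  then have far: "poly S x > 0" if "x \<ge> b" for x using that S(2) by (meson less_le_trans)
  have Mc: "M < c" using c M by auto
  have "\<exists>y>M. poly S y = 0 \<and> sgn (c - y) = sgn (poly S c)"
  proof (cases "poly S c" "0 :: real" rule: linorder_cases)
    case less
    have "poly S (max b (c + 1)) > 0" using far by simp
    moreover have "c < max b (c + 1)" by simp
    ultimately obtain y where "c < y" "poly S y = 0"
      using poly_IVT_pos[of c "max b (c + 1)" S] less by auto
    then show ?thesis using less Mc by (intro exI[of _ y]) auto
  next
    case equal then show ?thesis using Mc by (intro exI[of _ c]) auto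
  next
    case greater
    then obtain y where "M < y" "y < c" "poly S y = 0"
      using poly_IVT_pos[OF Mc SM] by auto
    then show ?thesis using greater by (intro exI[of _ y]) auto
  qed
  then obtain y where y: "M < y" "poly S y = 0" "sgn (c - y) = sgn (poly S c)" by auto
  have "y \<notin> \<rho> ` (X - {M})" using \<rho>M y by force
  then show "card {x. poly S x = 0} = card X"
    unfolding all[OF y(1,2)] using X M(1) by (simp add: card_image[OF inj] card_gt_0_iff Suc_diff_Suc)
  have "z \<le> y" if "poly S z = 0" for z
    using that all[OF y(1,2)] \<rho>M y(1) by force
  then show "\<exists>y. poly S y = 0 \<and> (\<forall>z. poly S z = 0 \<longrightarrow> z \<le> y) \<and> sgn (c - y) = sgn (poly S c)"
    using y by auto
qed

text \<open>
  The substitution \<open>x = e * t\<close> reduces this to the preceding lemma. A negative \<open>e\<close> reverses the line, so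
  the same statement serves for the largest zero (\<open>e > 0\<close>) and for the smallest zero (\<open>e < 0\<close>).
\<close>

lemma zeros_of_interlaced_directed:
  fixes S :: "real poly" and e :: real
  assumes X: "finite X" "X \<noteq> {}" and e: "e \<noteq> 0"
    and S: "degree S = card X" "lead_coeff S = 1"
    and sign: "\<And>x. x \<in> X \<Longrightarrow> e * poly S x * (\<Prod>z\<in>X - {x}. x - z) < 0"
    and beyond: "\<And>x. x \<in> X \<Longrightarrow> x / e < 1"
  shows "card {x. poly S x = 0} = card X"
    and "\<exists>y. poly S y = 0 \<and> (\<forall>z. poly S z = 0 \<longrightarrow> z / e \<le> y / e) \<and>
             sgn (1 - y / e) = sgn (poly S e / (\<Prod>x\<in>X. e - x))"
proof -
  define n where "n = card X"
  have "n > 0" using X by (simp add: n_def card_gt_0_iff)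
  define T where "T = smult (1 / e ^ n) (pcompose S [:0, e:])"
  have T: "poly T t = poly S (e * t) / e ^ n" for t
    by (simp add: T_def poly_pcompose mult.commute)
  have degT: "degree T = n" using e S by (simp add: T_def degree_pcompose n_def)
  have lcT: "lead_coeff T = 1"
    unfolding T_def lead_coeff_smult using e S
    by (subst lead_coeff_comp) (auto simp: n_def)
  define Y where "Y = (\<lambda>x. x / e) ` X"
  have inj: "inj_on (\<lambda>x. x / e) B" for B using e by (auto simp: inj_on_def)
  have Y: "finite Y" "Y \<noteq> {}" "card Y = n" using X by (auto simp: Y_def n_def card_image[OF inj])
  have YX: "(\<Prod>z\<in>Y. (c / e) - z) = (\<Prod>z\<in>X. c - z) / e ^ n" for c
    unfolding Y_def prod.reindex[OF inj] by (simp add: diff_divide_distrib[symmetric] prod_dividef n_def)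
  have signT: "poly T t * (\<Prod>z\<in>Y - {t}. t - z) < 0" if t: "t \<in> Y" for t
  proof -
    obtain x where x: "x \<in> X" "t = x / e" using t by (auto simp: Y_def)
    have "Y - {t} = (\<lambda>x. x / e) ` (X - {x})" using e x by (auto simp: Y_def)
    then have "(\<Prod>z\<in>Y - {t}. t - z) = (\<Prod>z\<in>X - {x}. x - z) / e ^ (n - 1)"
      using x X by (simp add: prod.reindex[OF inj] diff_divide_distrib[symmetric] prod_dividef n_def)
    then have "poly T t * (\<Prod>z\<in>Y - {t}. t - z) =
        (e * poly S x * (\<Prod>z\<in>X - {x}. x - z)) / (e ^ n * e ^ n)"
      using e \<open>n > 0\<close> by (cases n) (auto simp: T x field_simps)
    moreover have "e ^ n * e ^ n > 0" using e by (metis not_real_square_gt_zero power_eq_0_iff)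
    ultimately show ?thesis using sign[OF x(1)] by (simp add: divide_neg_pos)
  qed
  note * = zeros_of_interlaced[OF Y(1,2), of T 1]
  have cond: "degree T = card Y" "lead_coeff T > 0" "\<And>t. t \<in> Y \<Longrightarrow> t < 1"
    using degT lcT Y beyond by (auto simp: Y_def)
  have roots: "{x. poly T x = 0} = (\<lambda>x. x / e) ` {x. poly S x = 0}"
  proof (intro equalityI subsetI)
    fix t assume "t \<in> {x. poly T x = 0}"
    then show "t \<in> (\<lambda>x. x / e) ` {x. poly S x = 0}"
      using e by (intro image_eqI[of _ _ "e * t"]) (auto simp: T)
  qed (use e in \<open>auto simp: T\<close>)
  show "card {x. poly S x = 0} = card X"
    using *(1)[OF cond(1,2) signT cond(3)] Y unfolding roots card_image[OF inj] by (simp add: n_def)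
  obtain t where t: "poly T t = 0" "\<And>z. poly T z = 0 \<Longrightarrow> z \<le> t" "sgn (1 - t) = sgn (poly T 1)"
    using *(2)[OF cond(1,2) signT cond(3)] by auto
  have "(\<Prod>z\<in>Y. 1 - z) > 0" using cond(3) by (intro prod_pos) auto
  then have pos: "(\<Prod>x\<in>X. e - x) / e ^ n > 0" using YX[of e] e by simp
  have "sgn (poly S e / (\<Prod>x\<in>X. e - x)) = sgn (poly T 1 / ((\<Prod>x\<in>X. e - x) / e ^ n))"
    using e by (simp add: T)
  also have "\<dots> = sgn (poly T 1)" using pos by (metis div_by_1 sgn_divide sgn_pos)
  finally have "sgn (1 - (e * t) / e) = sgn (poly S e / (\<Prod>x\<in>X. e - x))" using t e by simp
  moreover have "z / e \<le> (e * t) / e" if "poly S z = 0" for z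
    using t(2)[of "z / e"] that e by (simp add: T)
  moreover have "poly S (e * t) = 0" using t(1) e by (simp add: T)
  ultimately show "\<exists>y. poly S y = 0 \<and> (\<forall>z. poly S z = 0 \<longrightarrow> z / e \<le> y / e) \<and>
             sgn (1 - y / e) = sgn (poly S e / (\<Prod>x\<in>X. e - x))" by blast
qed

lemma sorted_list_of_simple_zeros:
  fixes S :: "real poly"
  assumes "S \<noteq> 0" "card {x. poly S x = 0} = degree S"
  defines "xs \<equiv> sorted_list_of_multiset (proots S)"
  shows "sorted xs" "set xs = {x. poly S x = 0}" "length xs = degree S"
proof -
  show "sorted xs" by (simp add: xs_def)
  show set: "set xs = {x. poly S x = 0}" using assms(1) by (simp add: xs_def)
  have "length xs = size (proots S)"
    by (metis mset_sorted_list_of_multiset size_mset xs_def)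
  then show "length xs = degree S"
    using size_proots_le[of S] card_length[of xs] assms(2) set by simp
qed

lemma nth_sorted_zeros:
  fixes S :: "real poly"
  assumes "S \<noteq> 0" "card {x. poly S x = 0} = degree S" "poly S y = 0"
  shows smallest_zero_eq_nth:
      "(\<And>z. poly S z = 0 \<Longrightarrow> y \<le> z) \<Longrightarrow> sorted_list_of_multiset (proots S) ! 0 = y"
    and largest_zero_eq_nth:
      "(\<And>z. poly S z = 0 \<Longrightarrow> z \<le> y) \<Longrightarrow> sorted_list_of_multiset (proots S) ! (degree S - 1) = y"
proof -
  define xs where "xs = sorted_list_of_multiset (proots S)"
  note xs = sorted_list_of_simple_zeros[OF assms(1,2), folded xs_def]
  obtain j where j: "j < degree S" "xs ! j = y"
    using assms(3) xs(2,3) in_set_conv_nth[of y xs] by auto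
  have root: "poly S (xs ! i) = 0" if "i < degree S" for i
    using that xs(2,3) nth_mem[of i xs] by auto
  show "xs ! 0 = y" if "\<And>z. poly S z = 0 \<Longrightarrow> y \<le> z"
    using that[OF root[of 0]] j sorted_nth_mono[OF xs(1), of 0 j] xs(3) by force
  show "xs ! (degree S - 1) = y" if "\<And>z. poly S z = 0 \<Longrightarrow> z \<le> y"
    using that[OF root[of "degree S - 1"]] j sorted_nth_mono[OF xs(1), of j "degree S - 1"] xs(3) by force
qed

section \<open>Orthogonal polynomials of a positive functional\<close>

text \<open>
  The set \<open>A\<close> stands for the support of the functional. Strict positivity
  for every nonzero polynomial forces \<open>A\<close> to be infinite.
\<close>

locale positive_functional =
  fixes u :: "real poly \<Rightarrow> real" and A :: "real set"
  assumes u_add: "u (p + r) = u p + u r"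
    and u_smult: "u (smult c p) = c * u p"
    and u_pos: "p \<noteq> 0 \<Longrightarrow> (\<And>x. x \<in> A \<Longrightarrow> poly p x \<ge> 0) \<Longrightarrow> u p > 0"
begin

lemma u_0 [simp]: "u 0 = 0"
  using u_smult[of 0 0] by simp

lemma u_minus: "u (- p) = - u p"
  using u_smult[of "-1" p] by simp

lemma u_diff: "u (p - r) = u p - u r"
  using u_add[of p "- r"] by (simp add: u_minus)

lemma u_sum: "u (\<Sum>i\<in>I. f i) = (\<Sum>i\<in>I. u (f i))"
  by (induction I rule: infinite_finite_induct) (simp_all add: u_add)

lemma u_square_pos: "p \<noteq> 0 \<Longrightarrow> u (p * p) > 0"
  by (rule u_pos) auto

text \<open>
  Everything about zeros of orthogonal polynomials comes from this one observation: if \<open>P = r * s\<close>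
  and \<open>s\<close> has constant sign on the support, then \<open>P * r = r\<^sup>2 * s\<close> has constant sign too, while
  orthogonality gives \<open>u (P * r) = 0\<close>.
\<close>

lemma orthogonal_no_signed_factor:
  assumes orth: "\<And>p. degree p < degree P \<Longrightarrow> u (P * p) = 0"
    and P: "P = r * s" "P \<noteq> 0" and s: "degree s > 0"
    and sign: "(\<forall>x\<in>A. poly s x \<ge> 0) \<or> (\<forall>x\<in>A. poly s x \<le> 0)"
  shows False
proof -
  have nz: "r \<noteq> 0" "s \<noteq> 0" using P by auto
  then have "degree r < degree P" using s unfolding P(1) by (simp add: degree_mult_eq)
  then have z: "u (P * r) = 0" by (rule orth)
  have Pr: "P * r = r * r * s" by (simp add: P(1) mult_ac)
  from sign show False
  proof
    assume "\<forall>x\<in>A. poly s x \<ge> 0"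
    then have "u (P * r) > 0" unfolding Pr using nz by (intro u_pos) auto
    then show False using z by simp
  next
    assume "\<forall>x\<in>A. poly s x \<le> 0"
    then have "u (- (P * r)) > 0" unfolding Pr using nz
      by (intro u_pos) (auto simp: mult_nonneg_nonpos)
    then show False using z by (simp add: u_minus)
  qed
qed

context
  fixes P :: "real poly"
  assumes orth: "\<And>p. degree p < degree P \<Longrightarrow> u (P * p) = 0" and nz: "P \<noteq> 0"
begin

text \<open>
  The factors of constant sign to be excluded are the square of a linear factor and a factor without
  real zeros.
\<close>

lemma orthogonal_zeros_simple_real: "card {x. poly P x = 0} = degree P"
proof -
  define X where "X = {x. poly P x = 0}"
  have fin: "finite X" unfolding X_def using poly_roots_finite[OF nz] .
  obtain R where R: "P = (\<Prod>x\<in>X. [:- x, 1:]) * R"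
    using prod_linear_factors_dvd[OF fin, of P] by (auto simp: X_def elim: dvdE)
  have Rnz: "poly R c \<noteq> 0" for c
  proof
    assume c: "poly R c = 0"
    then have "c \<in> X" unfolding X_def by (subst R) simp
    obtain R' where R': "R = [:- c, 1:] * R'" using c by (auto simp: poly_eq_0_iff_dvd elim: dvdE)
    have "P = ((\<Prod>x\<in>X - {c}. [:- x, 1:]) * R') * ([:- c, 1:] * [:- c, 1:])"
      by (subst R, subst prod.remove[OF fin \<open>c \<in> X\<close>]) (simp only: R' mult_ac)
    moreover have "degree ([:- c, 1:] * [:- c, 1:]) > 0" by simp
    moreover have "\<forall>x\<in>A. poly ([:- c, 1:] * [:- c, 1:]) x \<ge> 0" by (simp del: mult_pCons_left mult_pCons_right)
    ultimately show False using orthogonal_no_signed_factor[OF orth _ nz] by blast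
  qed
  from poly_no_root_same_sign[OF this]
  have "(\<forall>x\<in>A. poly R x \<ge> 0) \<or> (\<forall>x\<in>A. poly R x \<le> 0)" by (auto intro: less_imp_le)
  then have "degree R = 0" using orthogonal_no_signed_factor[OF orth R nz] by blast
  moreover have "degree P = card X + degree R"
    using nz unfolding R by (subst degree_mult_eq) (auto simp: degree_prod_linear_factors simp del: mult_eq_0_iff prod_zero_iff)
  ultimately show ?thesis by (simp add: X_def)
qed

text \<open>
  The excluded factor is \<open>x - c\<close>.
\<close>

lemma orthogonal_zero_inside_hull:
  assumes "poly P c = 0"
  shows "\<exists>x\<in>A. x < c" "\<exists>x\<in>A. c < x"
proof -
  obtain r where "P = r * [:- c, 1:]" using assms by (metis dvdE mult.commute poly_eq_0_iff_dvd)
  from orthogonal_no_signed_factor[OF orth this nz] show "\<exists>x\<in>A. x < c" "\<exists>x\<in>A. c < x"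
    by (force simp: not_less)+
qed

text \<open>
  The excluded factor is \<open>(x - c) * (x - d)\<close>: two zeros cannot share a gap of the support.
\<close>

lemma orthogonal_zeros_separated:
  assumes "poly P c = 0" "poly P d = 0" "c \<noteq> d"
  shows "\<exists>x\<in>A. (x - c) * (x - d) < 0"
proof -
  obtain r where r: "P = [:- c, 1:] * r" using assms(1) by (metis dvdE poly_eq_0_iff_dvd)
  have "poly r d = 0" using assms(2,3) by (simp add: r)
  then obtain t where "r = [:- d, 1:] * t" by (metis dvdE poly_eq_0_iff_dvd)
  then have P: "P = t * ([:- c, 1:] * [:- d, 1:])" by (simp only: r mult_ac)
  have "\<not> (\<forall>x\<in>A. poly ([:- c, 1:] * [:- d, 1:]) x \<ge> 0)"
    using orthogonal_no_signed_factor[OF orth P nz] by auto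
  then show ?thesis by (simp add: not_le del: mult_pCons_left mult_pCons_right)
qed

end

end

section \<open>Adding one point-mass term to the inner product\<close>

text \<open>
  The functional \<open>L\<close> is arbitrary here; it is later the \<open>q\<close>-derivative at \<open>\<alpha>\<close>. The inner product in
  question is \<open>u (p * r) + N * L p * L r\<close>.
\<close>

locale sobolev_type = positive_functional +
  fixes U :: "nat \<Rightarrow> real poly" and L :: "real poly \<Rightarrow> real"
  assumes degree_U: "degree (U n) = n" and lead_coeff_U: "lead_coeff (U n) = 1"
    and orthogonal_U: "degree p < n \<Longrightarrow> u (U n * p) = 0"
    and L_add: "L (p + r) = L p + L r" and L_smult: "L (smult c p) = c * L p"
begin

lemma L_diff: "L (p - r) = L p - L r"
  using L_add[of p "smult (-1) r"] L_smult[of "-1" r] by simp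

lemma L_sum: "L (\<Sum>i\<in>I. f i) = (\<Sum>i\<in>I. L (f i))"
proof -
  have "L 0 = 0" using L_smult[of 0 0] by simp
  then show ?thesis by (induction I rule: infinite_finite_induct) (simp_all add: L_add)
qed

lemma U_nz: "U n \<noteq> 0"
  using lead_coeff_U[of n] by auto

definition norm2 :: "nat \<Rightarrow> real" where "norm2 k = u (U k * U k)"

lemma norm2_pos: "norm2 k > 0"
  unfolding norm2_def by (rule u_square_pos[OF U_nz])

text \<open>
  With \<open>L\<close> the \<open>q\<close>-derivative at \<open>\<alpha>\<close> this is the reproducing kernel, differentiated in its second
  argument at \<open>\<alpha>\<close>, as a polynomial in the first one. The number \<open>L (kernel n)\<close> is then the kernel
  differentiated in both arguments.
\<close>

definition kernel :: "nat \<Rightarrow> real poly" where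
  "kernel n = (\<Sum>k<n. smult (L (U k) / norm2 k) (U k))"

lemma degree_kernel: "n > 0 \<Longrightarrow> degree (kernel n) < n"
  unfolding kernel_def by (rule degree_sum_less) (auto simp: degree_U)

lemma L_kernel: "L (kernel n) = (\<Sum>k<n. (L (U k))\<^sup>2 / norm2 k)"
  by (simp add: kernel_def L_sum L_smult power2_eq_square)

lemma L_kernel_nonneg: "L (kernel n) \<ge> 0"
  unfolding L_kernel by (intro sum_nonneg divide_nonneg_pos norm2_pos) auto

text \<open>
  The kernel is the Riesz representative of \<open>L\<close> on the polynomials of degree less than \<open>n\<close>. In the
  induction step \<open>p\<close> is split into a multiple of \<open>U n\<close> and a polynomial of smaller degree.
\<close>

lemma kernel_reproduces_L: "n > 0 \<Longrightarrow> degree p < n \<Longrightarrow> u (kernel n * p) = L p"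
proof (induction n arbitrary: p)
  case (Suc n)
  define c where "c = coeff p n"
  define p' where "p' = p - smult c (U n)"
  have p: "p = p' + smult c (U n)" by (simp add: p'_def)
  have K: "kernel (Suc n) = kernel n + smult (L (U n) / norm2 n) (U n)" by (simp add: kernel_def)
  have dp: "degree p \<le> n" using Suc.prems by simp
  show ?case
  proof (cases "n = 0")
    case True
    have "U 0 = 1" using degree_U[of 0] lead_coeff_U[of 0] by (auto elim!: degree_eq_zeroE simp: one_pCons)
    moreover have "p = [:c:]" using dp True by (auto simp: c_def elim!: degree_eq_zeroE)
    moreover have "u [:b:] = b * u 1" "L [:b:] = b * L 1" for b
      using u_smult[of b 1] L_smult[of b 1] by simp_all
    ultimately show ?thesis
      using norm2_pos[of 0] True by (simp add: kernel_def u_smult L_smult norm2_def)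
  next
    case False
    have "degree p' \<le> n" unfolding p'_def
      using dp by (intro degree_diff_le) (auto simp: degree_U intro: order.trans[OF degree_smult_le])
    moreover have "coeff p' n = 0"
      using lead_coeff_U[of n] by (simp add: p'_def c_def degree_U)
    ultimately have dp': "degree p' < n"
      using False by (metis le_neq_implies_less leading_coeff_0_iff degree_0 not_gr_zero)
    have "u (kernel n * U n) = 0"
      using orthogonal_U[of "kernel n" n] degree_kernel[of n] False by (simp add: mult.commute)
    moreover have "u (U n * p') = 0" using orthogonal_U[OF dp'] .
    moreover have "u (kernel n * p') = L p'" using Suc.IH[OF _ dp'] False by simp
    moreover have "u (U n * U n) \<noteq> 0" using norm2_pos[of n] by (simp add: norm2_def)
    moreover have "u (kernel (Suc n) * p) = u (kernel n * p') + c * u (kernel n * U n)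
        + L (U n) / norm2 n * (u (U n * p') + c * u (U n * U n))"
      unfolding K p by (simp add: ring_distribs u_add u_smult)
    ultimately show ?thesis by (subst p) (simp add: L_add L_smult norm2_def)
  qed
qed simp

text \<open>
  Orthogonality to all \<open>p\<close> of smaller degree says that \<open>u (P * p)\<close> is \<open>- N * L P\<close> times \<open>L p\<close>, so the
  correction to \<open>U n\<close> must be a multiple of the kernel; applying \<open>L\<close> determines the factor.
\<close>

definition sobolev_poly :: "real \<Rightarrow> nat \<Rightarrow> real poly" where
  "sobolev_poly N n = U n - smult (N * L (U n) / (1 + N * L (kernel n))) (kernel n)"

context
  fixes N :: real and n :: nat
  assumes N: "N \<ge> 0" and n: "n > 0"
begin

lemma mass_denominator_pos: "1 + N * L (kernel n) > 0"
  using N L_kernel_nonneg[of n] by (simp add: add_pos_nonneg)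

lemma degree_lead_coeff_sobolev_poly:
  "degree (sobolev_poly N n) = n" "lead_coeff (sobolev_poly N n) = 1"
proof -
  let ?r = "smult (N * L (U n) / (1 + N * L (kernel n))) (kernel n)"
  have r: "degree ?r < n" using degree_kernel[OF n] by (rule le_less_trans[OF degree_smult_le])
  have *: "sobolev_poly N n = - ?r + U n" by (simp add: sobolev_poly_def)
  show d: "degree (sobolev_poly N n) = n"
    unfolding * using r by (subst degree_add_eq_right) (simp_all add: degree_U)
  show "lead_coeff (sobolev_poly N n) = 1"
    unfolding d unfolding * using coeff_eq_0[OF r] lead_coeff_U[of n] by (simp only: coeff_add coeff_minus degree_U)
qed

lemma L_sobolev_poly: "L (sobolev_poly N n) = L (U n) / (1 + N * L (kernel n))"
  using mass_denominator_pos by (simp add: sobolev_poly_def L_diff L_smult field_simps)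

lemma sobolev_poly_orthogonal:
  assumes "degree p < n"
  shows "u (sobolev_poly N n * p) + N * L (sobolev_poly N n) * L p = 0"
proof -
  have "u (sobolev_poly N n * p) = - (N * L (U n) / (1 + N * L (kernel n)) * L p)"
    using orthogonal_U[OF assms] kernel_reproduces_L[OF n assms]
    by (simp add: sobolev_poly_def left_diff_distrib u_diff u_smult)
  then show ?thesis unfolding L_sobolev_poly by simp
qed

lemma sobolev_poly_unique:
  assumes "degree P = n" "lead_coeff P = 1"
    and orth: "\<And>p. degree p < n \<Longrightarrow> u (P * p) + N * L P * L p = 0"
  shows "P = sobolev_poly N n"
proof (rule ccontr)
  define d where "d = P - sobolev_poly N n"
  assume "P \<noteq> sobolev_poly N n"
  then have "d \<noteq> 0" by (simp add: d_def)
  note S = degree_lead_coeff_sobolev_poly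
  have "coeff d n = 0" using assms(1,2) S by (simp add: d_def)
  moreover have "degree d \<le> n" unfolding d_def using assms(1) S by (intro degree_diff_le) auto
  ultimately have deg: "degree d < n"
    using \<open>d \<noteq> 0\<close> by (metis le_neq_implies_less leading_coeff_0_iff)
  have "d * d = P * d - sobolev_poly N n * d"
    by (subst (1) d_def) (rule left_diff_distrib)
  moreover have "N * L d * L d = N * L P * L d - N * L (sobolev_poly N n) * L d"
    by (subst (1) d_def) (simp add: L_diff algebra_simps)
  ultimately have "u (d * d) + N * L d * L d = 0"
    using orth[OF deg] sobolev_poly_orthogonal[OF deg] by (simp add: u_diff)
  moreover have "u (d * d) > 0" using u_square_pos[OF \<open>d \<noteq> 0\<close>] .
  moreover have "N * L d * L d \<ge> 0" using N by (simp add: mult.assoc)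
  ultimately show False by linarith
qed

text \<open>
  This ties the sign of the Sobolev-type polynomial \<open>S\<close> at a zero \<open>x\<close> of \<open>U n\<close> to the sign of \<open>L\<close> on
  the cofactor \<open>g\<close>. After subtracting the right multiple of \<open>g\<close>, \<open>S\<close> vanishes at \<open>x\<close>; multiplied by
  \<open>g\<close>, the difference becomes a multiple of \<open>U n\<close> by a polynomial of smaller degree and is
  annihilated by \<open>u\<close>.
\<close>

lemma sobolev_poly_at_zero_of_U:
  assumes g: "U n = [:- x, 1:] * g"  and gx: "poly g x \<noteq> 0"
  shows "poly (sobolev_poly N n) x / poly g x * u (g * g) = - N * L (sobolev_poly N n) * L g"
proof -
  define S where "S = sobolev_poly N n"
  define c where "c = poly S x / poly g x"
  have "g \<noteq> 0" using gx by auto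
  then have dg: "degree g = n - 1" using degree_U[of n] unfolding g by (subst (asm) degree_mult_eq) auto
  then have dgn: "degree g < n" using n by simp
  have "poly (S - smult c g) x = 0" using gx by (simp add: c_def)
  then obtain t where t: "S - smult c g = [:- x, 1:] * t" by (metis dvdE poly_eq_0_iff_dvd)
  have "degree (S - smult c g) \<le> n"
    using dgn degree_lead_coeff_sobolev_poly unfolding S_def
    by (intro degree_diff_le) (auto intro: order.trans[OF degree_smult_le])
  then have "t = 0 \<or> degree t < n" unfolding t by (cases "t = 0") (auto simp: degree_mult_eq simp del: mult_pCons_left)
  then have "u (U n * t) = 0" using orthogonal_U by auto
  moreover have "S * g = U n * t + smult c (g * g)"
  proof -
    have "S = [:- x, 1:] * t + smult c g" using t by (simp only: diff_eq_eq)
    then have "S * g = ([:- x, 1:] * t + smult c g) * g" by (simp only:)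
    also have "\<dots> = ([:- x, 1:] * g) * t + smult c (g * g)"
      by (simp only: distrib_right mult_smult_left) (simp only: mult_ac)
    finally show ?thesis by (simp only: g)
  qed
  ultimately have "u (S * g) = c * u (g * g)" by (simp add: u_add u_smult)
  then show ?thesis using sobolev_poly_orthogonal[OF dgn] by (simp add: c_def S_def)
qed

end

end

section \<open>Al-Salam-Carlitz polynomials\<close>

lemma qpoch_0 [simp]: "qpoch b q 0 = 1"
  by (simp add: qpoch_def)

lemma qpoch_Suc: "qpoch b q (Suc k) = qpoch b q k * (1 - b * q ^ k)"
  by (simp add: qpoch_def)

lemma qpoch_Suc_shift: "qpoch b q (Suc k) = (1 - b) * qpoch (b * q) q k"
  unfolding qpoch_def by (subst prod.lessThan_Suc_shift) (simp add: mult_ac)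

locale al_salam_carlitz =
  fixes q a :: real
  assumes q_pos: "0 < q" and q_less_1: "q < 1" and a_neg: "a < 0"
begin

abbreviation U :: "nat \<Rightarrow> real poly" where "U \<equiv> ASC_U a q"

text \<open>
  The coefficients of \<open>U n\<close> in the basis \<open>\<Prod>j<k. x - q ^ j\<close>. The formula makes sense for all \<open>k\<close> and
  gives \<open>0\<close> for \<open>k > n\<close>, so that sums for different \<open>n\<close> can share one range.
\<close>

definition shifted_coeff :: "nat \<Rightarrow> nat \<Rightarrow> real" where
  "shifted_coeff n k = (- a) ^ n * q ^ (n choose 2) *
     (qpoch (1 / q ^ n) q k / qpoch q q k * (q / a) ^ k)"

lemma qpoch_q_pos: "qpoch q q k > 0"
  unfolding qpoch_def using q_pos q_less_1
  by (intro prod_pos) (auto simp: power_Suc_less_one simp flip: power_Suc)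

lemma shifted_coeff_eq_0: "n < k \<Longrightarrow> shifted_coeff n k = 0"
  unfolding shifted_coeff_def qpoch_def using q_pos by (auto intro!: bexI[of _ n])

lemma poly_U_eq_sum:
  assumes "n < K"
  shows "poly (U n) x = (\<Sum>k<K. shifted_coeff n k * (\<Prod>j<k. x - q ^ j))"
proof -
  have "poly (U n) x = (\<Sum>k\<le>n. shifted_coeff n k * (\<Prod>j<k. x - q ^ j))"
    by (simp add: ASC_U_def shifted_coeff_def poly_sum poly_prod sum_distrib_left
        power_int_minus mult_ac divide_inverse)
  also have "\<dots> = (\<Sum>k<K. shifted_coeff n k * (\<Prod>j<k. x - q ^ j))"
    using assms by (intro sum.mono_neutral_left) (auto simp: shifted_coeff_eq_0)
  finally show ?thesis .
qed

lemma choose_two_Suc: "Suc m choose 2 = (m choose 2) + m"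
  by (simp add: numeral_2_eq_2)

lemma shifted_coeff_recurrence_0:
  "shifted_coeff (Suc m) 0 = shifted_coeff (Suc (Suc m)) 0 + (1 + a) * q ^ Suc m * shifted_coeff (Suc m) 0
     - a * q ^ m * (1 - q ^ Suc m) * shifted_coeff m 0"
  by (simp add: shifted_coeff_def choose_two_Suc power_add algebra_simps)

text \<open>
  The three-term recurrence, read off in the basis \<open>f\<^sub>k = (\<Prod>j<k. x - q ^ j)\<close>, where
  \<open>x * f\<^sub>k = f\<^sub>k\<^sub>+\<^sub>1 + q ^ k * f\<^sub>k\<close>. All four coefficients are explicit multiples of one
  quantity \<open>T\<close>; the factor \<open>1 - q ^ Suc m\<close> is what makes this possible for \<open>shifted_coeff m\<close>.
\<close>

lemma shifted_coeff_recurrence_Suc: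
  "shifted_coeff (Suc m) i + q ^ Suc i * shifted_coeff (Suc m) (Suc i) =
     shifted_coeff (Suc (Suc m)) (Suc i) + (1 + a) * q ^ Suc m * shifted_coeff (Suc m) (Suc i)
     - a * q ^ m * (1 - q ^ Suc m) * shifted_coeff m (Suc i)"
proof -
  define y z where "y = q ^ m" and "z = q ^ i"
  define G where "G = (- a) ^ m * q ^ (m choose 2)"
  define A where "A = qpoch (1 / (q * y)) q i"
  define B where "B = qpoch q q i"
  define R where "R = (q / a) ^ i"
  have nz: "q \<noteq> 0" "a \<noteq> 0" "y \<noteq> 0" "B \<noteq> 0" using q_pos a_neg qpoch_q_pos[of i] by (auto simp: y_def B_def)
  have "B * (1 - q * z) > 0" using qpoch_q_pos[of "Suc i"] by (simp add: qpoch_Suc B_def z_def)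
  then have nz': "1 - q * z \<noteq> 0" using nz by auto
  have A1: "qpoch (1 / (q * (q * y))) q (Suc i) = (1 - 1 / (q * (q * y))) * A"
    using nz by (subst qpoch_Suc_shift) (simp add: A_def)
  have "(1 - 1 / (q * y)) * qpoch (1 / y) q (Suc i) = qpoch (1 / (q * y)) q (Suc (Suc i))"
    using nz by (subst qpoch_Suc_shift[of _ _ "Suc i"]) simp
  also have "\<dots> = A * (1 - z / (q * y)) * (1 - q * z / (q * y))"
    by (simp add: qpoch_Suc A_def z_def)
  finally have "- (q * y) * ((1 - 1 / (q * y)) * qpoch (1 / y) q (Suc i)) =
      - (q * y) * (A * (1 - z / (q * y)) * (1 - q * z / (q * y)))" by (simp only:)
  moreover have "- (q * y) * ((1 - 1 / (q * y)) * w) = (1 - q * y) * w" for w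
    using nz by (simp add: field_simps)
  ultimately have A2: "(1 - q * y) * qpoch (1 / y) q (Suc i) =
      - (q * y) * (A * (1 - z / (q * y)) * (1 - q * z / (q * y)))" by (simp only:)
  have c1: "shifted_coeff (Suc m) i = - a * y * G * (A / B * R)"
    by (simp add: shifted_coeff_def choose_two_Suc power_add y_def G_def A_def B_def R_def)
  have c2: "shifted_coeff (Suc m) (Suc i) =
      - a * y * G * (A * (1 - z / (q * y)) / (B * (1 - q * z)) * (R * (q / a)))"
    by (simp add: shifted_coeff_def choose_two_Suc power_add y_def z_def G_def A_def B_def R_def
        qpoch_Suc mult_ac)
  have c3: "shifted_coeff (Suc (Suc m)) (Suc i) =
      a * a * y * y * q * G * ((1 - 1 / (q * (q * y))) * A / (B * (1 - q * z)) * (R * (q / a)))"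
    unfolding A1[symmetric]
    by (simp add: shifted_coeff_def choose_two_Suc power_add y_def z_def G_def B_def R_def
        qpoch_Suc[of q] mult_ac)
  have "(1 - q ^ Suc m) * shifted_coeff m (Suc i) =
      G * ((1 - q * y) * qpoch (1 / y) q (Suc i) / (B * (1 - q * z)) * (R * (q / a)))"
    by (simp add: shifted_coeff_def y_def z_def G_def B_def R_def qpoch_Suc[of q] mult_ac)
  then have c4: "(1 - q ^ Suc m) * shifted_coeff m (Suc i) =
      G * (- (q * y) * (A * (1 - z / (q * y)) * (1 - q * z / (q * y))) / (B * (1 - q * z)) * (R * (q / a)))"
    unfolding A2 .
  have pw: "q ^ Suc i = q * z" "q ^ Suc m = q * y" "q ^ m = y" by (simp_all add: y_def z_def)
  have c5: "a * q ^ m * (1 - q ^ Suc m) * shifted_coeff m (Suc i) =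
      a * y * ((1 - q ^ Suc m) * shifted_coeff m (Suc i))" by (simp add: y_def)
  define T where "T = G * A * R / (B * (1 - q * z))"
  have k1: "shifted_coeff (Suc m) i = - a * y * T * (1 - q * z)"
    unfolding c1 T_def using nz nz' by (simp add: field_simps)
  have k2: "shifted_coeff (Suc m) (Suc i) = - T * (q * y - z)"
    unfolding c2 T_def using nz nz' by (simp add: field_simps)
  have k3: "shifted_coeff (Suc (Suc m)) (Suc i) = a * y * T * (q * (q * y) - 1)"
    unfolding c3 T_def using nz nz' by (simp add: field_simps)
  have k4: "a * q ^ m * (1 - q ^ Suc m) * shifted_coeff m (Suc i) = - T * (q * y - z) * (q * y - q * z)"
    unfolding c5 c4 T_def using nz nz' by (simp add: field_simps)
  show ?thesis
    unfolding k4 k1 k2 k3 unfolding pw by (simp add: algebra_simps)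
qed

text \<open>
  Together with the values of \<open>U 0\<close> and \<open>U 1\<close>, this is all that is used of the explicit sum in
  what follows.
\<close>

lemma poly_U_recurrence:
  "poly (U (Suc (Suc n))) x =
     (x - (1 + a) * q ^ Suc n) * poly (U (Suc n)) x + a * q ^ n * (1 - q ^ Suc n) * poly (U n) x"
proof -
  define f where "f k = (\<Prod>j<k. x - q ^ j)" for k :: nat
  define K where "K = n + 4"
  have U: "poly (U m) x = shifted_coeff m 0 * f 0 + (\<Sum>i<K. shifted_coeff m (Suc i) * f (Suc i))"
    if "m \<le> n + 2" for m
    using poly_U_eq_sum[of m "Suc K" x] that unfolding sum.lessThan_Suc_shift f_def K_def by simp
  have "x * poly (U (Suc n)) x = (\<Sum>k<K. shifted_coeff (Suc n) k * (x * f k))"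
    by (subst poly_U_eq_sum[of _ K]) (auto simp: K_def f_def sum_distrib_left mult_ac)
  also have "\<dots> = (\<Sum>k<K. shifted_coeff (Suc n) k * f (Suc k)) + (\<Sum>k<K. q ^ k * shifted_coeff (Suc n) k * f k)"
    by (subst sum.distrib[symmetric]) (auto simp: f_def algebra_simps intro!: sum.cong)
  also have "(\<Sum>k<K. q ^ k * shifted_coeff (Suc n) k * f k) = (\<Sum>k<Suc K. q ^ k * shifted_coeff (Suc n) k * f k)"
  proof -
    have "shifted_coeff (Suc n) K = 0" by (rule shifted_coeff_eq_0) (simp add: K_def)
    then show ?thesis by simp
  qed
  also have "\<dots> = shifted_coeff (Suc n) 0 * f 0 + (\<Sum>i<K. q ^ Suc i * shifted_coeff (Suc n) (Suc i) * f (Suc i))"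
    unfolding sum.lessThan_Suc_shift by simp
  finally have "x * poly (U (Suc n)) x = shifted_coeff (Suc n) 0 * f 0 +
     (\<Sum>i<K. (shifted_coeff (Suc n) i + q ^ Suc i * shifted_coeff (Suc n) (Suc i)) * f (Suc i))"
    by (simp add: sum.distrib distrib_right)
  also have "\<dots> = (shifted_coeff (Suc (Suc n)) 0 + (1 + a) * q ^ Suc n * shifted_coeff (Suc n) 0
     - a * q ^ n * (1 - q ^ Suc n) * shifted_coeff n 0) * f 0 +
     (\<Sum>i<K. (shifted_coeff (Suc (Suc n)) (Suc i) + (1 + a) * q ^ Suc n * shifted_coeff (Suc n) (Suc i)
     - a * q ^ n * (1 - q ^ Suc n) * shifted_coeff n (Suc i)) * f (Suc i))"
    using shifted_coeff_recurrence_0[of n] by (simp only: shifted_coeff_recurrence_Suc)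
  also have "\<dots> = poly (U (Suc (Suc n))) x + (1 + a) * q ^ Suc n * poly (U (Suc n)) x
     - a * q ^ n * (1 - q ^ Suc n) * poly (U n) x"
    by (simp only: U le_add2 Suc_le_mono add_2_eq_Suc' order_refl le_SucI ring_distribs
        sum.distrib sum_subtractf sum_distrib_left mult.assoc)
  finally show ?thesis by (simp add: algebra_simps)
qed

lemma U_recurrence:
  "U (Suc (Suc n)) = [:- ((1 + a) * q ^ Suc n), 1:] * U (Suc n) + smult (a * q ^ n * (1 - q ^ Suc n)) (U n)"
  by (rule poly_ext) (simp add: poly_U_recurrence algebra_simps)

lemma U_0: "U 0 = 1"
  by (simp add: ASC_U_def binomial_eq_0 one_pCons)

lemma U_1: "U (Suc 0) = [:- (1 + a), 1:]"
proof (rule poly_ext)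
  fix x
  show "poly (U (Suc 0)) x = poly [:- (1 + a), 1:] x"
    using q_pos q_less_1 a_neg
    by (subst poly_U_eq_sum[of _ 2])
       (auto simp: shifted_coeff_def qpoch_def numeral_2_eq_2 field_simps)
qed

lemma degree_lead_coeff_U: "degree (U n) = n \<and> lead_coeff (U n) = 1"
proof (induction n rule: less_induct)
  case (less n)
  consider "n = 0" | "n = 1" | m where "n = Suc (Suc m)" by (metis One_nat_def not0_implies_Suc)
  then show ?case
  proof cases
    case (3 m)
    let ?r = "smult (a * q ^ m * (1 - q ^ Suc m)) (U m)"
    let ?l = "[:- ((1 + a) * q ^ Suc m), 1:]"
    have IH: "degree (U m) = m" "degree (U (Suc m)) = Suc m" "lead_coeff (U (Suc m)) = 1"
      using less.IH[of m] less.IH[of "Suc m"] 3 by auto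
    have nz: "U (Suc m) \<noteq> 0" using IH(3) by auto
    have d: "degree (?l * U (Suc m)) = n" using nz IH 3 by (subst degree_mult_eq) auto
    have lt: "degree ?r < degree (?l * U (Suc m))"
      unfolding d using IH(1) 3 degree_smult_le[of "a * q ^ m * (1 - q ^ Suc m)" "U m"] by linarith
    have "lead_coeff (?l * U (Suc m)) = 1" unfolding lead_coeff_mult IH(3) by simp
    then show ?thesis
      using degree_add_eq_left[OF lt] lead_coeff_add_le[OF lt] d
      unfolding 3 U_recurrence by (simp add: add.commute)
  qed (auto simp: U_0 U_1)
qed

text \<open>
  This is the lowering relation \<open>D\<^sub>q U\<^sub>n = [n]\<^sub>q U\<^sub>n\<^sub>-\<^sub>1\<close> cleared of denominators, so that it holds at
  \<open>x = 0\<close> as well. For \<open>n = 0\<close> the truncated index \<open>n - 1\<close> is harmless, as its coefficient vanishes.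
\<close>

lemma poly_U_q_shift:
  "poly (U n) (q * x) = poly (U n) x - (1 - q ^ n) * x * poly (U (n - 1)) x"
proof (induction n rule: less_induct)
  case (less n)
  consider "n = 0" | "n = 1" | "n = 2" | m where "n = Suc (Suc (Suc m))"
    by (metis One_nat_def not0_implies_Suc numeral_2_eq_2)
  then show ?case
  proof cases
    case 3
    then show ?thesis
      using poly_U_recurrence[of 0 x] poly_U_recurrence[of 0 "q * x"] by (simp add: numeral_2_eq_2 U_0 U_1 algebra_simps)
  next
    case (4 m)
    define y where "y = q ^ m"
    have pw: "q ^ Suc (Suc (Suc m)) = q * q * q * y" "q ^ Suc (Suc m) = q * q * y" "q ^ Suc m = q * y" "q ^ m = y"
      by (simp_all add: y_def)
    have s2: "poly (U (Suc (Suc m))) (q * x) = poly (U (Suc (Suc m))) x - (1 - q * q * y) * x * poly (U (Suc m)) x"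
      and s1: "poly (U (Suc m)) (q * x) = poly (U (Suc m)) x - (1 - q * y) * x * poly (U m) x"
      using less.IH[of "Suc (Suc m)"] less.IH[of "Suc m"] 4 by (simp_all add: y_def)
    have r3: "poly (U (Suc (Suc (Suc m)))) z = (z - (1 + a) * (q * q * y)) * poly (U (Suc (Suc m))) z
        + a * (q * y) * (1 - q * q * y) * poly (U (Suc m)) z"
      and r2: "poly (U (Suc (Suc m))) z = (z - (1 + a) * (q * y)) * poly (U (Suc m)) z
        + a * y * (1 - q * y) * poly (U m) z" for z
      using poly_U_recurrence[of "Suc m" z] poly_U_recurrence[of m z] unfolding pw by simp_all
    have "poly (U (Suc (Suc (Suc m)))) (q * x)
       = poly (U (Suc (Suc (Suc m)))) x - (1 - q * q * q * y) * x * poly (U (Suc (Suc m))) x"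
      unfolding r3 s2 s1 unfolding r2 by (simp add: algebra_simps)
    then show ?thesis using 4 by (simp add: y_def mult_ac)
  qed (auto simp: U_0 U_1 algebra_simps)
qed

definition q_deriv :: "real \<Rightarrow> real poly \<Rightarrow> real" where "q_deriv x p = q_diff q (poly p) x"

lemma q_deriv_eq: "x \<noteq> 0 \<Longrightarrow> q_deriv x p = (poly p (q * x) - poly p x) / ((q - 1) * x)"
  by (simp add: q_deriv_def q_diff_def)

lemma q_deriv_U:
  assumes "x \<noteq> 0"
  shows "q_deriv x (U n) = q_number q n * poly (U (n - 1)) x"
proof -
  have "q - 1 \<noteq> 0" "1 - q \<noteq> 0" using q_less_1 by auto
  then show ?thesis using assms
    by (simp add: q_deriv_eq poly_U_q_shift q_number_def divide_simps) (simp add: algebra_simps)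
qed

end

section \<open>Growth beyond an end of the interval\<close>

text \<open>
  Both ends of \<open>[a, 1]\<close> are treated at once: \<open>e\<close> is the end near \<open>\<alpha>\<close>, and \<open>\<alpha> / e > 1\<close> says that \<open>\<alpha>\<close>
  lies outside the interval beyond \<open>e\<close>. Dividing by \<open>e\<close> turns "beyond the end" into "greater than
  \<open>1\<close>" in both cases.
\<close>

locale al_salam_carlitz_endpoint = al_salam_carlitz +
  fixes e \<alpha> :: real
  assumes endpoint: "e = 1 \<or> e = a" and beyond: "\<alpha> / e > 1"
begin

lemma e_nz: "e \<noteq> 0" and \<alpha>_nz: "\<alpha> \<noteq> 0"
  using endpoint beyond a_neg by auto

text \<open>
  At the two ends of the interval the three-term recurrence collapses to a recurrence of first
  order, which gives the value of \<open>U n\<close> there and its sign.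
\<close>

lemma poly_U_endpoint_Suc: "poly (U (Suc n)) e = - (a / e) * q ^ n * poly (U n) e"
proof (induction n)
  case (Suc n)
  define y w where "y = q ^ n" and "w = a / e"
  have "poly (U (Suc (Suc n))) e =
     ((e - (1 + a) * (q * y)) * (- (a / e) * y) + a * y * (1 - q * y)) * poly (U n) e"
    unfolding poly_U_recurrence Suc w_def[symmetric] by (simp add: y_def algebra_simps)
  also have "(e - (1 + a) * (q * y)) * (- (a / e) * y) + a * y * (1 - q * y) = (- (a / e) * (q * y)) * (- (a / e) * y)"
    using endpoint a_neg by (auto simp: field_simps)
  finally show ?case unfolding Suc by (simp add: y_def)
qed (use endpoint a_neg in \<open>auto simp: U_0 U_1\<close>)

lemma poly_U_endpoint_nz: "poly (U n) e \<noteq> 0"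
  using a_neg q_pos e_nz by (induction n) (auto simp: U_0 poly_U_endpoint_Suc)

definition ratio :: "nat \<Rightarrow> real" where "ratio n = poly (U n) \<alpha> / poly (U n) e"

lemma growth_const_pos: "- a / e\<^sup>2 > 0"
  using a_neg e_nz by (intro divide_pos_pos) auto

text \<open>
  The recurrence divided by the values at \<open>e\<close>. It holds for \<open>\<alpha>\<close> replaced by \<open>e\<close> and the ratio
  replaced by \<open>1\<close>; the difference of the two has positive coefficients.
\<close>

lemma ratio_recurrence:
  "(- a / e\<^sup>2) * q ^ Suc n * (ratio (Suc (Suc n)) - ratio (Suc n)) =
     (\<alpha> / e - 1) * ratio (Suc n) + (1 - q ^ Suc n) * (ratio (Suc n) - ratio n)"
proof -
  define E y where "E = poly (U n) e" and "y = q ^ n"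
  define X0 X1 where "X0 = poly (U n) \<alpha>" and "X1 = poly (U (Suc n)) \<alpha>"
  have nz: "E \<noteq> 0" "y \<noteq> 0" "q \<noteq> 0" "e \<noteq> 0" "a \<noteq> 0" using poly_U_endpoint_nz[of n] q_pos e_nz a_neg by (auto simp: E_def y_def)
  have E1: "poly (U (Suc n)) e = - (a / e) * y * E"
    and E2: "poly (U (Suc (Suc n))) e = - (a / e) * (q * y) * (- (a / e) * y * E)"
    by (simp_all add: poly_U_endpoint_Suc E_def y_def)
  have X2: "poly (U (Suc (Suc n))) \<alpha> = (\<alpha> - (1 + a) * (q * y)) * X1 + a * y * (1 - q * y) * X0"
    by (simp add: poly_U_recurrence X0_def X1_def y_def)
  have sum: "1 + a = e + a / e" using endpoint a_neg by auto
  show ?thesis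
    unfolding ratio_def E1 E2 X2 sum using nz
    by (simp add: X0_def[symmetric] X1_def[symmetric] E_def[symmetric] y_def[symmetric] field_simps power2_eq_square)
qed

lemma ratio_strictly_increasing: "0 < ratio n \<and> ratio n < ratio (Suc n)"
proof (induction n)
  case 0
  have "ratio (Suc 0) - 1 = (\<alpha> / e - 1) / (- a / e\<^sup>2)"
    unfolding ratio_def poly_U_endpoint_Suc using endpoint a_neg
    by (auto simp: U_0 U_1 field_simps power2_eq_square)
  also have "\<dots> > 0" by (rule divide_pos_pos[OF _ growth_const_pos]) (use beyond in simp)
  finally show ?case by (simp add: ratio_def U_0)
next
  case (Suc n)
  then have pos: "ratio (Suc n) > 0" by linarith
  have "(\<alpha> / e - 1) * ratio (Suc n) + (1 - q ^ Suc n) * (ratio (Suc n) - ratio n) > 0"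
    using Suc beyond pos q_pos q_less_1
    by (intro add_pos_nonneg mult_pos_pos mult_nonneg_nonneg) (auto intro: power_le_one simp del: power_Suc)
  then have "(- a / e\<^sup>2) * q ^ Suc n * (ratio (Suc (Suc n)) - ratio (Suc n)) > 0"
    by (simp only: ratio_recurrence)
  moreover have "(- a / e\<^sup>2) * q ^ Suc n > 0" using growth_const_pos q_pos by (intro mult_pos_pos) auto
  ultimately have "ratio (Suc (Suc n)) - ratio (Suc n) > 0" by (rule zero_less_mult_pos)
  then show ?case using pos by simp
qed

text \<open>
  The quantities \<open>e * slope n\<close> are nonnegative and strictly increasing, which is why the
  critical mass is positive.
\<close>

definition slope :: "nat \<Rightarrow> real" where "slope n = q_deriv \<alpha> (U n) / poly (U n) e"

lemma slope_0: "slope 0 = 0"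
  by (simp add: slope_def q_deriv_U[OF \<alpha>_nz] q_number_def)

lemma slope_Suc: "e * slope (Suc n) = (q_number q (Suc n) / q ^ n) * (ratio n / (- a / e\<^sup>2))"
  using e_nz q_pos a_neg poly_U_endpoint_nz[of n]
  by (simp add: slope_def ratio_def q_deriv_U[OF \<alpha>_nz] poly_U_endpoint_Suc field_simps power2_eq_square)

lemma q_number_quotient_increasing: "0 < q_number q (Suc n) / q ^ n \<and>
    q_number q (Suc n) / q ^ n < q_number q (Suc (Suc n)) / q ^ Suc n"
proof
  have s: "q ^ Suc n < 1" using q_pos q_less_1 by (intro power_Suc_less_one) auto
  then show "0 < q_number q (Suc n) / q ^ n" using q_pos q_less_1 by (simp add: q_number_def)
  have "q_number q (Suc n) / q ^ n = (1 - q ^ Suc n) * q / ((1 - q) * q ^ Suc n)"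
    using q_pos q_less_1 by (simp add: q_number_def)
  also have "\<dots> < (1 - q ^ Suc (Suc n)) / ((1 - q) * q ^ Suc n)"
    using q_pos q_less_1 by (intro divide_strict_right_mono mult_pos_pos) (auto simp: algebra_simps)
  also have "\<dots> = q_number q (Suc (Suc n)) / q ^ Suc n" by (simp add: q_number_def)
  finally show "q_number q (Suc n) / q ^ n < q_number q (Suc (Suc n)) / q ^ Suc n" .
qed

lemma slope_strictly_increasing: "0 \<le> e * slope n \<and> e * slope n < e * slope (Suc n)"
proof (cases n)
  case 0
  have "e * slope (Suc 0) > 0"
    unfolding slope_Suc
    by (intro mult_pos_pos divide_pos_pos[OF _ growth_const_pos]
        conjunct1[OF q_number_quotient_increasing] conjunct1[OF ratio_strictly_increasing])
  then show ?thesis using 0 by (simp add: slope_0)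
next
  case (Suc m)
  have r: "0 < ratio m / (- a / e\<^sup>2)" "ratio m / (- a / e\<^sup>2) < ratio (Suc m) / (- a / e\<^sup>2)"
    using divide_pos_pos[OF conjunct1[OF ratio_strictly_increasing] growth_const_pos]
      divide_strict_right_mono[OF conjunct2[OF ratio_strictly_increasing] growth_const_pos] by blast+
  have "(q_number q (Suc m) / q ^ m) * (ratio m / (- a / e\<^sup>2)) <
        (q_number q (Suc (Suc m)) / q ^ Suc m) * (ratio (Suc m) / (- a / e\<^sup>2))"
    using q_number_quotient_increasing[of m] r by (intro mult_strict_mono) auto
  moreover have "0 \<le> (q_number q (Suc m) / q ^ m) * (ratio m / (- a / e\<^sup>2))"
    using q_number_quotient_increasing[of m] r by (intro mult_nonneg_nonneg) auto
  ultimately show ?thesis unfolding Suc slope_Suc by blast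
qed

lemma slope_strict_mono: "k < n \<Longrightarrow> e * slope k < e * slope n"
  using strict_monoD[of "\<lambda>n. e * slope n" k n] slope_strictly_increasing strict_mono_Suc_iff by blast

lemma slope_sign: "n > 0 \<Longrightarrow> e * slope n > 0"
  using slope_strict_mono[of 0 n] by (simp add: slope_0)

end

section \<open>The orthogonality functional\<close>

text \<open>
  The weights are bounded and polynomials are bounded on the points \<open>b * q ^ k\<close>, so the series is
  dominated by a geometric one.
\<close>

lemma summable_weighted_polynomial:
  fixes q b :: real and W :: "nat \<Rightarrow> real"
  assumes q: "0 < q" "q < 1" and W: "\<And>k. W k > 0" "W \<longlonglongrightarrow> 1"
  shows "summable (\<lambda>k. poly p (b * q ^ k) * W k * q ^ k)"
proof -
  have "(\<lambda>k. b * q ^ k) \<longlonglongrightarrow> b * 0"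
    by (intro tendsto_mult_left LIMSEQ_realpow_zero) (use q in auto)
  then have "(\<lambda>k. poly p (b * q ^ k)) \<longlonglongrightarrow> poly p (b * 0)" by (rule tendsto_poly)
  then have "(\<lambda>k. poly p (b * q ^ k) * W k) \<longlonglongrightarrow> poly p (b * 0) * 1" by (rule tendsto_mult[OF _ W(2)])
  then have "Bseq (\<lambda>k. poly p (b * q ^ k) * W k)" by (intro convergent_imp_Bseq convergentI)
  then obtain K where K: "\<And>k. norm (poly p (b * q ^ k) * W k) \<le> K" by (auto simp: Bseq_def)
  show ?thesis
  proof (rule summable_comparison_test')
    show "summable (\<lambda>k. K * q ^ k)" using q by (intro summable_mult summable_geometric) auto
    show "norm (poly p (b * q ^ k) * W k * q ^ k) \<le> K * q ^ k" for k
      using K[of k] q by (simp add: abs_mult mult_right_mono)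
  qed
qed

text \<open>
  The values \<open>w k\<close> are the tails of one convergent infinite product with positive factors, whence all
  three claims. For suitable \<open>c\<close> they are the values of the weight on either half of the
  support.
\<close>

lemma q_product_tail:
  fixes q c :: real
  assumes q: "0 < q" "q < 1" and c: "c < 0"
  defines "w \<equiv> \<lambda>k. qpoch_inf2 (q ^ Suc k) (c * q ^ Suc k) q"
  shows "w k > 0" "w k = (1 - q ^ Suc k) * (1 - c * q ^ Suc k) * w (Suc k)" "w \<longlonglongrightarrow> 1"
proof -
  define v where "v j = (1 - q ^ Suc j) * (1 - c * q ^ Suc j)" for j
  have v_pos: "v j > 0" for j
  proof -
    have "q ^ Suc j < 1" using q by (intro power_Suc_less_one) auto
    moreover have "c * q ^ Suc j < 0" using c q by (intro mult_neg_pos) auto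
    ultimately show ?thesis unfolding v_def by (intro mult_pos_pos) linarith+
  qed
  have "summable (\<lambda>j. norm (v j - 1))"
  proof (rule summable_comparison_test')
    show "summable (\<lambda>j. (1 + 2 * \<bar>c\<bar>) * q ^ j)" using q by (intro summable_mult summable_geometric) auto
    fix j
    have s: "0 \<le> q ^ Suc j" "q ^ Suc j \<le> q ^ j" "q ^ Suc j \<le> 1"
      using q by (auto intro: power_le_one power_decreasing simp del: power_Suc)
    define s where "s = q ^ Suc j"
    have "\<bar>v j - 1\<bar> = \<bar>s * (c * s - 1 - c)\<bar>" unfolding v_def s_def[symmetric] by (simp add: algebra_simps)
    also have "\<dots> = s * \<bar>c * s - 1 - c\<bar>" using s(1) unfolding s_def[symmetric] by (simp add: abs_mult)
    also have "\<bar>c * s - 1 - c\<bar> \<le> \<bar>c * s\<bar> + 1 + \<bar>c\<bar>" by linarith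
    also have "\<bar>c * s\<bar> \<le> \<bar>c\<bar>" using s by (simp add: abs_mult s_def mult_left_le)
    finally have "\<bar>v j - 1\<bar> \<le> s * (\<bar>c\<bar> + 1 + \<bar>c\<bar>)" using s by (simp add: s_def mult_left_mono)
    also have "\<dots> \<le> q ^ j * (\<bar>c\<bar> + 1 + \<bar>c\<bar>)" using s by (intro mult_right_mono) (auto simp: s_def)
    finally show "norm (norm (v j - 1)) \<le> (1 + 2 * \<bar>c\<bar>) * q ^ j" by (simp add: algebra_simps)
  qed
  then have cv: "convergent_prod v"
    using abs_convergent_prod_conv_summable abs_convergent_prod_imp_convergent_prod by blast
  have w: "w k = (\<Prod>j. v (j + k))" for k
    unfolding w_def qpoch_inf2_def v_def
    by (rule arg_cong[of _ _ prodinf]) (auto simp: fun_eq_iff power_add mult_ac)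
  have cvk: "convergent_prod (\<lambda>j. v (j + k))" for k
    using cv by (rule convergent_prod_ignore_initial_segment)
  have nz: "v j \<noteq> 0" for j using v_pos[of j] by simp
  have tot: "prodinf v \<noteq> 0" using prodinf_nonzero[OF cv nz] .
  have pos: "w k > 0" for k
  proof -
    have "w k \<ge> 0" unfolding w
      using has_prod_nonneg[OF convergent_prod_has_prod[OF cvk[of k]]] v_pos by (auto intro: less_imp_le)
    moreover have "w k \<noteq> 0" unfolding w by (rule prodinf_nonzero[OF cvk nz])
    ultimately show ?thesis by simp
  qed
  then show "w k > 0" .
  show "w k = (1 - q ^ Suc k) * (1 - c * q ^ Suc k) * w (Suc k)"
    unfolding v_def[of k, symmetric]
    using prodinf_split_initial_segment[OF cvk[of k], of 1] nz by (simp add: w mult.commute)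
  have "(\<lambda>k. \<Prod>i<k. v i) \<longlonglongrightarrow> prodinf v"
    using has_prod_imp_tendsto'[OF convergent_prod_has_prod[OF cv]] .
  then have "(\<lambda>k. prodinf v / (\<Prod>i<k. v i)) \<longlonglongrightarrow> prodinf v / prodinf v"
    using tot by (intro tendsto_intros)
  moreover have "prodinf v / (\<Prod>i<k. v i) = w k" for k
    using prodinf_split_initial_segment[OF cv, of k] nz by (simp add: w field_simps)
  ultimately show "w \<longlonglongrightarrow> 1" using tot by simp
qed

context al_salam_carlitz begin

definition asc_u :: "real poly \<Rightarrow> real" where "asc_u p = ASC_functional a q (poly p)"

definition support :: "real set" where "support = range (\<lambda>k. q ^ k) \<union> range (\<lambda>k. a * q ^ k)"

definition weight_1 :: "nat \<Rightarrow> real" where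
  "weight_1 k = qpoch_inf2 (q * q ^ k) (inverse a * q * q ^ k) q"

definition weight_a :: "nat \<Rightarrow> real" where
  "weight_a k = qpoch_inf2 (q * (a * q ^ k)) (inverse a * q * (a * q ^ k)) q"

lemma weight_1:
  "weight_1 k > 0" "weight_1 k = (1 - q ^ Suc k) * (1 - q ^ Suc k / a) * weight_1 (Suc k)"
  "weight_1 \<longlonglongrightarrow> 1"
proof -
  have "inverse a < 0" using a_neg by simp
  note t = q_product_tail[OF q_pos q_less_1 this]
  have w: "weight_1 = (\<lambda>k. qpoch_inf2 (q ^ Suc k) (inverse a * q ^ Suc k) q)"
    by (simp add: weight_1_def fun_eq_iff mult_ac)
  show "weight_1 k > 0" "weight_1 k = (1 - q ^ Suc k) * (1 - q ^ Suc k / a) * weight_1 (Suc k)" "weight_1 \<longlonglongrightarrow> 1"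
    using t unfolding w by (simp_all add: divide_inverse mult.commute)
qed

lemma qpoch_inf2_commute: "qpoch_inf2 b c q = qpoch_inf2 c b q"
  by (simp add: qpoch_inf2_def mult.commute)

lemma weight_a:
  "weight_a k > 0" "weight_a k = (1 - q ^ Suc k) * (1 - a * q ^ Suc k) * weight_a (Suc k)"
  "weight_a \<longlonglongrightarrow> 1"
proof -
  note t = q_product_tail[OF q_pos q_less_1 a_neg]
  have w: "weight_a = (\<lambda>k. qpoch_inf2 (q ^ Suc k) (a * q ^ Suc k) q)"
  proof
    fix k
    have "inverse a * q * (a * q ^ k) = q ^ Suc k" "q * (a * q ^ k) = a * q ^ Suc k"
      using a_neg by simp_all
    then show "weight_a k = qpoch_inf2 (q ^ Suc k) (a * q ^ Suc k) q"
      unfolding weight_a_def by (simp only: qpoch_inf2_commute)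
  qed
  show "weight_a k > 0" "weight_a k = (1 - q ^ Suc k) * (1 - a * q ^ Suc k) * weight_a (Suc k)" "weight_a \<longlonglongrightarrow> 1"
    using t unfolding w by simp_all
qed

lemma asc_u_eq: "asc_u p = (1 - q) * (\<Sum>k. poly p (q ^ k) * weight_1 k * q ^ k)
    + (- a) * (1 - q) * (\<Sum>k. poly p (a * q ^ k) * weight_a k * q ^ k)"
  by (simp add: asc_u_def ASC_functional_def q_integral_def weight_1_def weight_a_def)

lemma summable_1: "summable (\<lambda>k. poly p (q ^ k) * weight_1 k * q ^ k)"
  and summable_a: "summable (\<lambda>k. poly p (a * q ^ k) * weight_a k * q ^ k)"
  using summable_weighted_polynomial[OF q_pos q_less_1 weight_1(1,3), of p 1]
    summable_weighted_polynomial[OF q_pos q_less_1 weight_a(1,3), of p a] by simp_all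

text \<open>
  All weights are positive, and the support has infinitely many points in \<open>(0, 1]\<close>, so a
  nonzero polynomial does not vanish on all of them.
\<close>

lemma asc_u_pos:
  assumes "p \<noteq> 0" and nonneg: "\<And>x. x \<in> support \<Longrightarrow> poly p x \<ge> 0"
  shows "asc_u p > 0"
proof -
  have "infinite (range (\<lambda>k. q ^ k))"
    by (intro range_inj_infinite linorder_injI)
      (use power_strict_decreasing[OF _ q_pos q_less_1] in force)
  then have "\<not> range (\<lambda>k. q ^ k) \<subseteq> {x. poly p x = 0}"
    using poly_roots_finite[OF assms(1)] finite_subset by blast
  then obtain i where "poly p (q ^ i) \<noteq> 0" by auto
  then have "poly p (q ^ i) > 0" using nonneg[of "q ^ i"] by (auto simp: support_def less_le)
  then have "(\<Sum>k. poly p (q ^ k) * weight_1 k * q ^ k) > 0"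
    using nonneg weight_1(1) q_pos
    by (intro suminf_pos2[OF summable_1, of _ i] mult_nonneg_nonneg mult_pos_pos)
       (auto simp: support_def intro: less_imp_le)
  moreover have "(\<Sum>k. poly p (a * q ^ k) * weight_a k * q ^ k) \<ge> 0"
    using nonneg weight_a(1) q_pos
    by (intro suminf_nonneg[OF summable_a] mult_nonneg_nonneg)
       (auto simp: support_def intro: less_imp_le)
  ultimately show ?thesis
    unfolding asc_u_eq using a_neg q_less_1 by (intro add_pos_nonneg mult_pos_pos mult_nonneg_nonneg) auto
qed

sublocale positive_functional asc_u support
proof
  fix p r :: "real poly" and c :: real
  show "asc_u (p + r) = asc_u p + asc_u r"
    unfolding asc_u_eq poly_add distrib_right
      suminf_add[OF summable_1 summable_1, symmetric] suminf_add[OF summable_a summable_a, symmetric]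
    by (simp add: algebra_simps)
  show "asc_u (smult c p) = c * asc_u p"
    using suminf_mult[OF summable_1[of p], of c] suminf_mult[OF summable_a[of p], of c]
    by (simp add: asc_u_eq algebra_simps)
qed (rule asc_u_pos)

text \<open>
  A \<open>q\<close>-analogue of integrating a total derivative. The weight satisfies
  \<open>w (x / q) = (1 - x) * (1 - x / a) * w x\<close>, so on each half of the support the summands telescope.
  The boundary terms vanish at \<open>1\<close> and at \<open>a\<close>, and the two limits at the common accumulation point
  \<open>0\<close> cancel, because the weight tends to \<open>1\<close> along both halves.
\<close>

lemma pearson:
  assumes "\<And>x. x * poly h x = (1 - x) * (a - x) * poly g x - a * poly g (q * x)"
  shows "asc_u h = 0"
proof -
  have q0: "(\<lambda>k. b * q ^ k) \<longlonglongrightarrow> b * 0" for b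
    by (intro tendsto_mult_left LIMSEQ_realpow_zero) (use q_pos q_less_1 in auto)
  have g0: "(\<lambda>k. poly g (b * q ^ k)) \<longlonglongrightarrow> poly g (b * 0)" for b
    using q0[of b] by (rule tendsto_poly)
  define G1 where "G1 k = (1 - q ^ k) * (a - q ^ k) * poly g (q ^ k) * weight_1 k" for k
  define Ga where "Ga k = (1 - a * q ^ k) * (a - a * q ^ k) * poly g (a * q ^ k) * weight_a k" for k
  have "G1 \<longlonglongrightarrow> (1 - 1 * 0) * (a - 1 * 0) * poly g (1 * 0) * 1"
    unfolding G1_def using q0[of 1] g0[of 1] by (intro tendsto_intros weight_1) simp_all
  then have "(\<lambda>k. G1 k - G1 (Suc k)) sums (G1 0 - a * poly g 0)"
    by (intro telescope_sums') simp
  moreover have "G1 k - G1 (Suc k) = poly h (q ^ k) * weight_1 k * q ^ k" for k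
  proof -
    have "G1 (Suc k) = a * poly g (q * q ^ k) * weight_1 k"
      unfolding G1_def weight_1(2)[of k] using a_neg by (simp add: field_simps)
    then show ?thesis
      using arg_cong[OF assms[of "q ^ k"], of "\<lambda>z. z * weight_1 k"] by (simp add: G1_def algebra_simps)
  qed
  ultimately have s1: "(\<Sum>k. poly h (q ^ k) * weight_1 k * q ^ k) = - a * poly g 0"
    by (simp add: sums_iff G1_def)
  have "Ga \<longlonglongrightarrow> (1 - a * 0) * (a - a * 0) * poly g (a * 0) * 1"
    unfolding Ga_def by (intro tendsto_mult tendsto_diff tendsto_const q0 g0 weight_a)
  then have "(\<lambda>k. Ga k - Ga (Suc k)) sums (Ga 0 - a * poly g 0)"
    by (intro telescope_sums') simp
  moreover have "Ga k - Ga (Suc k) = a * (poly h (a * q ^ k) * weight_a k * q ^ k)" for k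
  proof -
    have "Ga (Suc k) = a * poly g (q * (a * q ^ k)) * weight_a k"
      unfolding Ga_def weight_a(2)[of k] by (simp add: algebra_simps)
    then show ?thesis
      using arg_cong[OF assms[of "a * q ^ k"], of "\<lambda>z. z * weight_a k"] by (simp add: Ga_def algebra_simps)
  qed
  ultimately have "(\<lambda>k. a * (poly h (a * q ^ k) * weight_a k * q ^ k)) sums (- a * poly g 0)"
    by (simp add: Ga_def)
  then have sa: "a * (\<Sum>k. poly h (a * q ^ k) * weight_a k * q ^ k) = - a * poly g 0"
    using suminf_mult[OF summable_a[of h], of a] by (simp add: sums_iff)
  have "asc_u h = (1 - q) * (- a * poly g 0 - a * (\<Sum>k. poly h (a * q ^ k) * weight_a k * q ^ k))"
    unfolding asc_u_eq s1 by (simp add: algebra_simps)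
  then show ?thesis unfolding sa by simp
qed

text \<open>
  The Pearson equation for \<open>g = U (Suc m)\<close> relates the values of the functional at three consecutive
  polynomials. The coefficient at \<open>U m\<close> vanishes for \<open>m = 0\<close>, so the nonzero value at \<open>U 0\<close>
  never enters.
\<close>

lemma asc_u_U: "n > 0 \<Longrightarrow> asc_u (U n) = 0"
proof (induction n rule: less_induct)
  case (less n)
  consider "n = 1" | m where "n = Suc (Suc m)" using less.prems by (metis One_nat_def not0_implies_Suc not_gr_zero)
  then show ?case
  proof cases
    case 1
    have "asc_u (U 1) = 0"
      by (rule pearson[of _ 1]) (simp add: U_1 algebra_simps)
    then show ?thesis using 1 by simp
  next
    case (2 m)
    \<comment> \<open>The Pearson equation for \<open>g = U (Suc m)\<close>, rewritten with the recurrence.\<close>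
    define y where "y = q ^ m"
    define h where "h = U (Suc (Suc m)) + smult ((1 + a) * (q * y - 1)) (U (Suc m))
       + smult (a * (1 - q * y) * (1 - y)) (U m)"
    have "asc_u h = 0"
    proof (rule pearson[of _ "U (Suc m)"])
      fix x
      have s1: "poly (U (Suc m)) (q * x) = poly (U (Suc m)) x - (1 - q * y) * x * poly (U m) x"
        using poly_U_q_shift[of "Suc m" x] by (simp add: y_def)
      have s2: "poly (U (Suc (Suc m))) x =
          (x - (1 + a) * (q * y)) * poly (U (Suc m)) x + a * y * (1 - q * y) * poly (U m) x"
        using poly_U_recurrence[of m x] by (simp add: y_def)
      show "x * poly h x = (1 - x) * (a - x) * poly (U (Suc m)) x - a * poly (U (Suc m)) (q * x)"
        unfolding h_def s1 poly_add poly_smult s2 by (simp add: algebra_simps)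
    qed
    moreover have "asc_u (U (Suc m)) = 0" using less.IH[of "Suc m"] 2 by simp
    moreover have "(1 - y) * asc_u (U m) = 0" using less.IH[of m] 2 by (cases "m = 0") (auto simp: y_def)
    ultimately have "asc_u (U (Suc (Suc m))) = 0" by (auto simp: h_def u_add u_smult)
    then show ?thesis using 2 by simp
  qed
qed

text \<open>
  The recurrence trades a factor \<open>x\<close> for a change of the index by at most one, which reduces
  orthogonality to \<open>asc_u_U\<close>.
\<close>

lemma asc_u_U_monom: "m < n \<Longrightarrow> asc_u (U n * monom 1 m) = 0"
proof (induction m arbitrary: n)
  case 0
  then show ?case using asc_u_U[of n] by (simp add: monom_0 flip: one_pCons)
next
  case (Suc m)
  then obtain i where n: "n = Suc i" by (cases n) auto
  have "[:0, 1:] * U (Suc i) = U (Suc (Suc i)) + smult ((1 + a) * q ^ Suc i) (U (Suc i))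
      - smult (a * q ^ i * (1 - q ^ Suc i)) (U i)"
    by (rule poly_ext) (simp add: poly_U_recurrence algebra_simps)
  moreover have "U (Suc i) * monom 1 (Suc m) = ([:0, 1:] * U (Suc i)) * monom 1 m"
    by (simp add: monom_Suc)
  ultimately have "U (Suc i) * monom 1 (Suc m) =
      U (Suc (Suc i)) * monom 1 m + smult ((1 + a) * q ^ Suc i) (U (Suc i) * monom 1 m)
      - smult (a * q ^ i * (1 - q ^ Suc i)) (U i * monom 1 m)"
    by (simp only: distrib_right left_diff_distrib mult_smult_left)
  then show ?case using Suc by (simp add: n u_add u_diff u_smult)
qed

lemma asc_u_orthogonal:
  assumes "degree p < n"
  shows "asc_u (U n * p) = 0"
proof -
  have "U n * p = (\<Sum>i\<le>degree p. smult (coeff p i) (U n * monom 1 i))"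
    by (subst (1) poly_as_sum_of_monoms[symmetric]) (simp add: sum_distrib_left smult_monom flip: mult_smult_right)
  then show ?thesis using assms by (simp add: u_sum u_smult asc_u_U_monom)
qed

end

section \<open>Zeros of the Sobolev-type polynomials\<close>

context al_salam_carlitz_endpoint begin

sublocale sobolev_type asc_u support U "q_deriv \<alpha>"
proof
  fix p r :: "real poly" and c :: real and n :: nat
  show "degree (U n) = n" using degree_lead_coeff_U by blast
  show "lead_coeff (U n) = 1" using degree_lead_coeff_U by blast
  show "degree p < n \<Longrightarrow> asc_u (U n * p) = 0" by (rule asc_u_orthogonal)
  show "q_deriv \<alpha> (p + r) = q_deriv \<alpha> p + q_deriv \<alpha> r"
    by (simp add: q_deriv_eq[OF \<alpha>_nz] add_divide_distrib[symmetric] algebra_simps)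
  show "q_deriv \<alpha> (smult c p) = c * q_deriv \<alpha> p"
    by (simp add: q_deriv_eq[OF \<alpha>_nz] right_diff_distrib)
qed

abbreviation zeros :: "nat \<Rightarrow> real set" where "zeros n \<equiv> {x. poly (U n) x = 0}"

lemma finite_zeros: "finite (zeros n)"
  using poly_roots_finite[OF U_nz] .

lemma orthogonal_U': "degree p < degree (U n) \<Longrightarrow> asc_u (U n * p) = 0"
  by (rule orthogonal_U) (simp add: degree_U)

lemma card_zeros: "card (zeros n) = n"
  using orthogonal_zeros_simple_real[OF orthogonal_U' U_nz] by (simp add: degree_U)

lemma U_eq_prod: "U n = (\<Prod>x\<in>zeros n. [:- x, 1:])"
  by (rule monic_eq_prod_linear_factors[OF finite_zeros _ _ lead_coeff_U])
     (auto simp: card_zeros degree_U)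

lemma zeros_nonempty: "n > 0 \<Longrightarrow> zeros n \<noteq> {}"
  using card_zeros[of n] by (metis card.empty less_irrefl)

lemma support_gap: "x \<in> support \<Longrightarrow> x / e \<le> q \<or> x / e = 1"
proof -
  have 1: "q ^ k \<le> q \<or> q ^ k = 1" for k
    using q_pos q_less_1 by (cases k) (auto intro: mult_left_le power_le_one)
  have 2: "a * q ^ k \<le> q" "q ^ k / a \<le> q" for k
  proof -
    have "a * q ^ k < 0" "q ^ k / a < 0" using a_neg q_pos by (auto intro: mult_neg_pos divide_pos_neg)
    then show "a * q ^ k \<le> q" "q ^ k / a \<le> q" using q_pos by linarith+
  qed
  show "x \<in> support \<Longrightarrow> x / e \<le> q \<or> x / e = 1"
    using endpoint a_neg 2 by (auto simp: support_def) (use 1 in blast)+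
qed

lemma zeros_before_endpoint:
  assumes "x \<in> zeros n"
  shows "x / e < 1"
proof -
  obtain y z where yz: "y \<in> support" "y < x" "z \<in> support" "x < z"
    using orthogonal_zero_inside_hull[OF orthogonal_U' U_nz, of n x] assms by auto
  have "\<exists>s\<in>support. x / e < s / e"
    using endpoint a_neg yz by (auto simp: divide_less_cancel)
  then show ?thesis using support_gap q_less_1 by fastforce
qed

text \<open>
  Two zeros have a point of the support between them, and \<open>q * e\<close> is the last such point before
  \<open>e\<close>.
\<close>

lemma zeros_separated:
  assumes "x \<in> zeros n" "z \<in> zeros n" "x / e < z / e"
  shows "x / e < q"
proof -
  obtain s where s: "s \<in> support" "(s - x) * (s - z) < 0"
    using orthogonal_zeros_separated[OF orthogonal_U' U_nz, of n x z] assms by auto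
  have "(s / e - x / e) * (s / e - z / e) = (s - x) * (s - z) / e\<^sup>2"
    by (simp add: diff_divide_distrib[symmetric] power2_eq_square)
  also have "\<dots> < 0" using s e_nz by (intro divide_neg_pos) auto
  finally have "x / e < s / e" "s / e < z / e" using assms(3) by (auto simp: mult_less_0_iff)
  then show ?thesis using support_gap[OF s(1)] zeros_before_endpoint[OF assms(2)] by linarith
qed

definition cofactor :: "nat \<Rightarrow> real \<Rightarrow> real poly" where
  "cofactor n x = (\<Prod>z\<in>zeros n - {x}. [:- z, 1:])"

lemma U_eq_cofactor: "x \<in> zeros n \<Longrightarrow> U n = [:- x, 1:] * cofactor n x"
  unfolding cofactor_def by (subst U_eq_prod) (rule prod.remove[OF finite_zeros])

lemma poly_cofactor: "poly (cofactor n x) y = (\<Prod>z\<in>zeros n - {x}. y - z)"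
  by (simp add: cofactor_def poly_prod)

text \<open>
  The point \<open>q * \<alpha>\<close> may lie inside the interval, so monotonicity of the cofactor
  beyond its zeros is not enough. By \<open>zeros_separated\<close>, however, at most one zero lies between
  \<open>q * \<alpha>\<close> and \<open>e\<close>. If there is one, the left product is negative and the right one positive;
  otherwise the products compare factor by factor.
\<close>

lemma cofactor_increment:
  assumes n: "n \<ge> 2" and x: "x \<in> zeros n"
  shows "(\<Prod>z\<in>zeros n - {x}. q * (\<alpha> / e) - z / e) < (\<Prod>z\<in>zeros n - {x}. \<alpha> / e - z / e)"
proof -
  define B where "B = zeros n - {x}"
  have B: "finite B" "B \<noteq> {}" "B \<subseteq> zeros n"
  proof -
    show "finite B" "B \<subseteq> zeros n" using finite_zeros by (auto simp: B_def)
    have "card B = n - 1" using x card_zeros[of n] finite_zeros by (simp add: B_def)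
    then show "B \<noteq> {}" using n by auto
  qed
  have less: "z / e < \<alpha> / e" if "z \<in> B" for z
    using zeros_before_endpoint[of z n] that B(3) beyond by force
  have qT: "q < q * (\<alpha> / e)" "q * (\<alpha> / e) < \<alpha> / e"
    using mult_strict_left_mono[OF beyond q_pos] mult_strict_right_mono[OF q_less_1, of "\<alpha> / e"] beyond by auto
  show ?thesis
  proof (cases "\<exists>z\<in>B. q * (\<alpha> / e) < z / e")
    case True
    then obtain z where z: "z \<in> B" "q * (\<alpha> / e) < z / e" by auto
    have "z' / e < q * (\<alpha> / e)" if "z' \<in> B - {z}" for z'
    proof (cases "z' / e" "z / e" rule: linorder_cases)
      case less
      have "z' / e < q" by (rule zeros_separated[OF _ _ less]) (use that z B(3) in auto)
      then show ?thesis using qT by linarith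
    next
      case equal then show ?thesis using that e_nz by auto
    next
      case greater
      have "z / e < q" by (rule zeros_separated[OF _ _ greater]) (use that z B(3) in auto)
      then show ?thesis using z qT by linarith
    qed
    then have "(\<Prod>z\<in>B - {z}. q * (\<alpha> / e) - z / e) > 0" by (intro prod_pos) auto
    then have "(\<Prod>z\<in>B. q * (\<alpha> / e) - z / e) < 0"
      using z by (subst prod.remove[OF B(1) z(1)]) (auto intro: mult_neg_pos)
    moreover have "(\<Prod>z\<in>B. \<alpha> / e - z / e) > 0" using less by (intro prod_pos) auto
    ultimately show ?thesis by (simp add: B_def)
  next
    case False
    obtain z where "z \<in> B" using B(2) by auto
    then show ?thesis
      unfolding B_def[symmetric]
      by (rule prod_mono_strict) (use False B(1) less qT(2) in \<open>force+\<close>)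
  qed
qed

lemma q_deriv_cofactor_sign:
  assumes n: "n \<ge> 2" and x: "x \<in> zeros n"
  shows "e ^ n * q_deriv \<alpha> (cofactor n x) > 0"
proof -
  define P1 P2 where "P1 = (\<Prod>z\<in>zeros n - {x}. \<alpha> / e - z / e)"
    and "P2 = (\<Prod>z\<in>zeros n - {x}. q * (\<alpha> / e) - z / e)"
  have card: "card (zeros n - {x}) = n - 1" using x card_zeros[of n] finite_zeros by simp
  have P: "poly (cofactor n x) \<alpha> = e ^ (n - 1) * P1" "poly (cofactor n x) (q * \<alpha>) = e ^ (n - 1) * P2"
    unfolding poly_cofactor P1_def P2_def card[symmetric] prod_constant[symmetric] prod.distrib[symmetric]
    using e_nz by (auto simp: algebra_simps intro!: prod.cong)
  have "e ^ n = e * e ^ (n - 1)" using n by (cases n) auto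
  then have "e ^ n * q_deriv \<alpha> (cofactor n x) = (e ^ (n - 1))\<^sup>2 * ((P1 - P2) / ((1 - q) * (\<alpha> / e)))"
    unfolding q_deriv_eq[OF \<alpha>_nz] P using e_nz \<alpha>_nz q_less_1 by (simp add: field_simps power2_eq_square)
  also have "\<dots> > 0"
  proof (rule mult_pos_pos)
    show "(e ^ (n - 1))\<^sup>2 > 0" using e_nz by simp
    show "(P1 - P2) / ((1 - q) * (\<alpha> / e)) > 0"
    proof (rule divide_pos_pos)
      show "P1 - P2 > 0" using cofactor_increment[OF assms] by (simp only: P1_def P2_def diff_gt_0_iff_gt)
      show "(1 - q) * (\<alpha> / e) > 0" by (rule mult_pos_pos) (use beyond q_less_1 in linarith)+
    qed
  qed
  finally show ?thesis .
qed

text \<open>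
  By \<open>sobolev_poly_at_zero_of_U\<close> only the signs of \<open>L S\<close> and of \<open>L g\<close> matter. The first is that of
  \<open>L (U n)\<close>, given by \<open>slope_sign\<close>, the second is given by \<open>q_deriv_cofactor_sign\<close>; the powers of \<open>e\<close>
  combine to a square.
\<close>

lemma sobolev_poly_interlaced:
  assumes n: "n \<ge> 2" and x: "x \<in> zeros n" and N: "N > 0"
  shows "e * poly (sobolev_poly N n) x * (\<Prod>z\<in>zeros n - {x}. x - z) < 0"
proof -
  define g S where "g = cofactor n x" and "S = sobolev_poly N n"
  have gx: "poly g x \<noteq> 0" using finite_zeros by (auto simp: g_def poly_cofactor)
  then have ugg: "asc_u (g * g) > 0" by (intro u_square_pos) auto
  have main: "poly S x / poly g x * asc_u (g * g) = - N * q_deriv \<alpha> S * q_deriv \<alpha> g"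
    unfolding S_def g_def
    using sobolev_poly_at_zero_of_U[OF _ _ U_eq_cofactor[OF x]] n N gx by (simp add: g_def)
  have d: "1 + N * q_deriv \<alpha> (kernel n) > 0" using mass_denominator_pos[of N n] n N by simp
  have "poly (U n) e = (\<Prod>z\<in>zeros n. e * (1 - z / e))"
    using e_nz by (subst U_eq_prod) (simp add: poly_prod right_diff_distrib)
  also have "\<dots> = e ^ n * (\<Prod>z\<in>zeros n. 1 - z / e)" by (simp add: prod.distrib card_zeros)
  finally have E: "poly (U n) e = e ^ n * (\<Prod>z\<in>zeros n. 1 - z / e)" .
  have pp: "(\<Prod>z\<in>zeros n. 1 - z / e) > 0" using zeros_before_endpoint by (intro prod_pos) force
  have "e * q_deriv \<alpha> S * q_deriv \<alpha> g
     = (e * slope n) * (\<Prod>z\<in>zeros n. 1 - z / e) * (e ^ n * q_deriv \<alpha> g) / (1 + N * q_deriv \<alpha> (kernel n))"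
    unfolding S_def using L_sobolev_poly[of N n] n N poly_U_endpoint_nz[of n] by (simp add: slope_def E)
  also have "\<dots> > 0"
    unfolding g_def
    by (rule divide_pos_pos[OF mult_pos_pos[OF mult_pos_pos[OF slope_sign pp] q_deriv_cofactor_sign[OF n x]] d])
       (use n in simp)
  finally have "N * (e * q_deriv \<alpha> S * q_deriv \<alpha> g) > 0" using N by simp
  then have "e * (poly S x / poly g x * asc_u (g * g)) < 0" unfolding main by (simp add: mult_ac)
  then have "(e * (poly S x / poly g x)) * asc_u (g * g) < 0" by (simp add: mult_ac)
  then have "e * (poly S x / poly g x) < 0" using ugg by (simp only: mult_less_0_iff) auto
  then have "e * (poly S x / poly g x) * (poly g x)\<^sup>2 < 0" by (rule mult_neg_pos) (use gx in simp)
  then show ?thesis using gx by (simp add: power2_eq_square g_def S_def poly_cofactor)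
qed

text \<open>
  The reciprocal of the critical mass. It is the value for which the Sobolev-type
  polynomial at \<open>e\<close> is a positive multiple of \<open>(1 - N * critical_inverse n) * U\<^sub>n e\<close>.
\<close>

definition critical_inverse :: "nat \<Rightarrow> real" where
  "critical_inverse n = slope n * poly (kernel n) e - q_deriv \<alpha> (kernel n)"

text \<open>
  As \<open>L (U k) = slope k * U\<^sub>k e\<close>, this number is a sum of terms
  \<open>slope k * (slope n - slope k)\<close> with nonnegative weights. The term for \<open>k = 0\<close> is zero, so
  \<open>n \<ge> 2\<close> is what makes the sum positive.
\<close>

lemma critical_inverse_pos:
  assumes "n \<ge> 2"
  shows "critical_inverse n > 0"
proof -
  define t where "t k = (poly (U k) e)\<^sup>2 / norm2 k * ((e * slope k) * (e * slope n - e * slope k)) / e\<^sup>2" for k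
  have L: "q_deriv \<alpha> (U k) = slope k * poly (U k) e" for k
    using poly_U_endpoint_nz[of k] by (simp add: slope_def)
  have "critical_inverse n = (\<Sum>k<n. t k)"
    unfolding critical_inverse_def L_kernel unfolding kernel_def poly_sum sum_distrib_left sum_subtractf[symmetric]
    using e_nz by (intro sum.cong) (auto simp: t_def L power2_eq_square diff_divide_distrib algebra_simps)
  also have "\<dots> > 0"
  proof (rule sum_pos2[of _ 1])
    have c: "(poly (U 1) e)\<^sup>2 / norm2 1 > 0"
      by (rule divide_pos_pos[OF _ norm2_pos]) (use poly_U_endpoint_nz[of 1] in simp)
    have s: "e * slope 1 > 0" by (rule slope_sign) simp
    have d: "e * slope n - e * slope 1 > 0" using slope_strict_mono[of 1 n] assms by simp
    show "t 1 > 0" unfolding t_def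
      by (rule divide_pos_pos[OF mult_pos_pos[OF c mult_pos_pos[OF s d]]]) (use e_nz in simp)
    show "t k \<ge> 0" if "k \<in> {..<n}" for k
    proof -
      have "(poly (U k) e)\<^sup>2 / norm2 k \<ge> 0"
        by (rule divide_nonneg_pos[OF _ norm2_pos]) simp
      moreover have "e * slope n - e * slope k \<ge> 0" using slope_strict_mono[of k n] that by simp
      ultimately show ?thesis unfolding t_def
        by (meson divide_nonneg_nonneg mult_nonneg_nonneg slope_strictly_increasing zero_le_power2)
    qed
  qed (use assms in auto)
  finally show ?thesis .
qed

lemma sobolev_poly_endpoint:
  assumes "N \<ge> 0" "n > 0"
  shows "poly (sobolev_poly N n) e / poly (U n) e = (1 - N * critical_inverse n) / (1 + N * q_deriv \<alpha> (kernel n))"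
  using mass_denominator_pos[OF assms] poly_U_endpoint_nz[of n]
  by (simp add: sobolev_poly_def critical_inverse_def slope_def field_simps)

text \<open>
  For \<open>N > 0\<close> the zeros of \<open>U n\<close> interlace as required by \<open>zeros_of_interlaced_directed\<close>.
  For \<open>N = 0\<close> the polynomial is \<open>U n\<close> itself, whose zeros all lie before \<open>e\<close>.
\<close>

lemma extreme_zero_of_sobolev_poly:
  assumes n: "n \<ge> 2" and N: "N \<ge> 0"
  defines "S \<equiv> sobolev_poly N n"
  shows "card {x. poly S x = 0} = n"
    and "\<exists>y. poly S y = 0 \<and> (\<forall>z. poly S z = 0 \<longrightarrow> z / e \<le> y / e) \<and>
             sgn (1 - y / e) = sgn (1 - N * critical_inverse n)"
proof -
  have "card {x. poly S x = 0} = n \<and> (\<exists>y. poly S y = 0 \<and> (\<forall>z. poly S z = 0 \<longrightarrow> z / e \<le> y / e) \<and>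
             sgn (1 - y / e) = sgn (1 - N * critical_inverse n))"
  proof (cases "N = 0")
    case True
    then have S: "S = U n" by (simp add: S_def sobolev_poly_def)
    define m where "m = Max ((\<lambda>z. z / e) ` zeros n)"
    have ne: "zeros n \<noteq> {}" using zeros_nonempty n by simp
    then have "m \<in> (\<lambda>z. z / e) ` zeros n" unfolding m_def using finite_zeros by (intro Max_in) auto
    then obtain y where y: "y \<in> zeros n" "m = y / e" by auto
    have "z / e \<le> y / e" if "z \<in> zeros n" for z
      unfolding y(2)[symmetric] m_def using that finite_zeros by (intro Max_ge) auto
    then show ?thesis using y zeros_before_endpoint[OF y(1)] card_zeros[of n] True by (auto simp: S)
  next
    case False
    then have N': "N > 0" using N by simp
    have ne: "zeros n \<noteq> {}" using zeros_nonempty n by simp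
    have prem: "degree S = card (zeros n)" "lead_coeff S = 1"
      using degree_lead_coeff_sobolev_poly[OF N, of n] n by (auto simp: S_def card_zeros)
    note z = zeros_of_interlaced_directed[OF finite_zeros ne e_nz prem
        sobolev_poly_interlaced[OF n _ N', folded S_def] zeros_before_endpoint]
    have "(\<Prod>x\<in>zeros n. e - x) = poly (U n) e" by (subst (2) U_eq_prod) (simp add: poly_prod)
    then have "sgn (poly S e / (\<Prod>x\<in>zeros n. e - x)) = sgn (1 - N * critical_inverse n)"
      using sobolev_poly_endpoint[OF N, of n] mass_denominator_pos[OF N, of n] n
      by (simp add: S_def sgn_divide del: sgn_divide) (simp add: sgn_divide)
    then show ?thesis using z by (simp add: card_zeros)
  qed
  then show "card {x. poly S x = 0} = n"
    and "\<exists>y. poly S y = 0 \<and> (\<forall>z. poly S z = 0 \<longrightarrow> z / e \<le> y / e) \<and>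
             sgn (1 - y / e) = sgn (1 - N * critical_inverse n)" by auto
qed

lemma poly_mult_fun: "(\<lambda>x. poly p x * poly r x) = poly (p * r)" for p r :: "real poly"
  by (simp add: fun_eq_iff)

lemma sobolev_U_eq:
  assumes "N \<ge> 0" "n > 0"
  shows "sobolev_U a q \<alpha> N n = sobolev_poly N n"
proof -
  have inner: "sobolev_inner a q \<alpha> N (poly P) (poly p) = asc_u (P * p) + N * q_deriv \<alpha> P * q_deriv \<alpha> p" for P p
    by (simp only: sobolev_inner_def asc_u_def q_deriv_def poly_mult_fun)
  show ?thesis
    unfolding sobolev_U_def inner
  proof (rule the_equality)
    show "degree (sobolev_poly N n) = n \<and> lead_coeff (sobolev_poly N n) = 1 \<and> (\<forall>p. degree p < n \<longrightarrow>
        asc_u (sobolev_poly N n * p) + N * q_deriv \<alpha> (sobolev_poly N n) * q_deriv \<alpha> p = 0)"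
      using degree_lead_coeff_sobolev_poly[OF assms] sobolev_poly_orthogonal[OF assms] by blast
  next
    fix P
    assume "degree P = n \<and> lead_coeff P = 1 \<and>
      (\<forall>p. degree p < n \<longrightarrow> asc_u (P * p) + N * q_deriv \<alpha> P * q_deriv \<alpha> p = 0)"
    then show "P = sobolev_poly N n" by (intro sobolev_poly_unique[OF assms]) blast+
  qed
qed

lemma critical_mass_eq: "critical_mass a q \<alpha> n e = inverse (critical_inverse n)"
proof -
  have norm: "ASC_norm2 a q k = norm2 k" for k
    by (simp only: ASC_norm2_def norm2_def asc_u_def power2_eq_square poly_mult_fun)
  have "ASC_kernel a q n 0 1 e \<alpha> = poly (kernel n) e"
    by (simp add: ASC_kernel_def kernel_def norm poly_sum q_deriv_def mult_ac)
  moreover have "ASC_kernel a q n 1 1 \<alpha> \<alpha> = q_deriv \<alpha> (kernel n)"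
    unfolding L_kernel by (simp add: ASC_kernel_def norm q_deriv_def power2_eq_square)
  ultimately show ?thesis
    by (simp add: critical_mass_def critical_inverse_def slope_def q_deriv_U[OF \<alpha>_nz])
qed

lemma critical_mass_pos: "n \<ge> 2 \<Longrightarrow> critical_mass a q \<alpha> n e > 0"
  using critical_inverse_pos by (simp add: critical_mass_eq)

text \<open>
  The index reflects that the zero farthest in the direction of \<open>e\<close> is the largest one for \<open>e = 1\<close> and the
  smallest one for \<open>e = a\<close>.
\<close>

lemma extreme_sobolev_zero:
  assumes n: "n \<ge> 2" and N: "N \<ge> 0"
  defines "\<eta> \<equiv> sobolev_zero a q \<alpha> N n (if e = 1 then n else 1)"
  shows "sgn (1 - \<eta> / e) = sgn (critical_mass a q \<alpha> n e - N)"
proof -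
  define S where "S = sobolev_poly N n"
  have n0: "n > 0" using n by simp
  have S: "degree S = n" "S \<noteq> 0"
    using degree_lead_coeff_sobolev_poly[OF N n0] by (auto simp: S_def)
  have card: "card {x. poly S x = 0} = degree S"
    using extreme_zero_of_sobolev_poly(1)[OF n N] S by (simp add: S_def)
  obtain y where y: "poly S y = 0" "\<And>z. poly S z = 0 \<Longrightarrow> z / e \<le> y / e"
    "sgn (1 - y / e) = sgn (1 - N * critical_inverse n)"
    using extreme_zero_of_sobolev_poly(2)[OF n N] by (auto simp: S_def)
  have "\<eta> = y"
  proof (cases "e = 1")
    case True
    then show ?thesis
      using largest_zero_eq_nth[OF S(2) card y(1)] y(2) S(1)
      by (simp add: \<eta>_def sobolev_zero_def sobolev_U_eq[OF N n0] S_def)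
  next
    case False
    then have "e = a" using endpoint by simp
    then have "y \<le> z" if "poly S z = 0" for z
      using y(2)[OF that] a_neg by (simp add: divide_le_cancel)
    from smallest_zero_eq_nth[OF S(2) card y(1) this] show ?thesis
      using False by (simp add: \<eta>_def sobolev_zero_def sobolev_U_eq[OF N n0] S_def)
  qed
  moreover have "1 - N * critical_inverse n = (critical_mass a q \<alpha> n e - N) * critical_inverse n"
    using critical_inverse_pos[OF n] by (simp add: critical_mass_eq field_simps)
  ultimately show ?thesis using y(3) critical_inverse_pos[OF n] by (simp add: sgn_mult)
qed

end

lemma compare_of_sgn_eq:
  assumes "sgn x = sgn y"
  shows "(0 < y \<longrightarrow> 0 < x) \<and> (y = 0 \<longrightarrow> x = 0) \<and> (y < 0 \<longrightarrow> x < (0::real))"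
  using assms by (auto simp: sgn_if split: if_splits)

theorem corollary2:
  fixes q a \<alpha> :: real and n :: nat
  assumes "0 < q" and "q < 1" and "a < 0" and "n \<ge> 2" and "\<alpha> \<notin> {a..1}"
  shows "(\<alpha> < a \<longrightarrow>
           (let N0 = critical_mass a q \<alpha> n a in
             N0 > 0 \<and>
             (\<forall>N\<ge>0.
               (N < N0 \<longrightarrow> sobolev_zero a q \<alpha> N n 1 > a) \<and>
               (N = N0 \<longrightarrow> sobolev_zero a q \<alpha> N n 1 = a) \<and>
               (N > N0 \<longrightarrow> sobolev_zero a q \<alpha> N n 1 < a)))) \<and>
         (\<alpha> > 1 \<longrightarrow>
           (let N0 = critical_mass a q \<alpha> n 1 in
             N0 > 0 \<and>
             (\<forall>N\<ge>0.
               (N < N0 \<longrightarrow> sobolev_zero a q \<alpha> N n n < 1) \<and>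
               (N = N0 \<longrightarrow> sobolev_zero a q \<alpha> N n n = 1) \<and>
               (N > N0 \<longrightarrow> sobolev_zero a q \<alpha> N n n > 1))))"
proof (intro conjI impI)
  assume "\<alpha> < a"
  interpret al_salam_carlitz_endpoint q a a \<alpha>
    by unfold_locales (use assms \<open>\<alpha> < a\<close> in auto)
  have "sgn (1 - sobolev_zero a q \<alpha> N n 1 / a) = sgn (critical_mass a q \<alpha> n a - N)" if "N \<ge> 0" for N
    using extreme_sobolev_zero[OF \<open>n \<ge> 2\<close> that] assms(3) by simp
  moreover have "sgn (1 - x / a) = sgn (x - a)" for x
    using assms(3) by (simp add: sgn_if field_simps)
  ultimately have sgn: "sgn (sobolev_zero a q \<alpha> N n 1 - a) = sgn (critical_mass a q \<alpha> n a - N)" if "N \<ge> 0" for N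
    using that by simp
  have "(N < critical_mass a q \<alpha> n a \<longrightarrow> sobolev_zero a q \<alpha> N n 1 > a) \<and>
      (N = critical_mass a q \<alpha> n a \<longrightarrow> sobolev_zero a q \<alpha> N n 1 = a) \<and>
      (N > critical_mass a q \<alpha> n a \<longrightarrow> sobolev_zero a q \<alpha> N n 1 < a)" if "N \<ge> 0" for N
    using compare_of_sgn_eq[OF sgn[OF that]] by auto
  then show "let N0 = critical_mass a q \<alpha> n a in
             N0 > 0 \<and>
             (\<forall>N\<ge>0.
               (N < N0 \<longrightarrow> sobolev_zero a q \<alpha> N n 1 > a) \<and>
               (N = N0 \<longrightarrow> sobolev_zero a q \<alpha> N n 1 = a) \<and>
               (N > N0 \<longrightarrow> sobolev_zero a q \<alpha> N n 1 < a))"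
    using critical_mass_pos[OF \<open>n \<ge> 2\<close>] by (simp only: Let_def) blast
next
  assume "\<alpha> > 1"
  interpret al_salam_carlitz_endpoint q a 1 \<alpha>
    by unfold_locales (use assms \<open>\<alpha> > 1\<close> in auto)
  have sgn: "sgn (1 - sobolev_zero a q \<alpha> N n n) = sgn (critical_mass a q \<alpha> n 1 - N)" if "N \<ge> 0" for N
    using extreme_sobolev_zero[OF \<open>n \<ge> 2\<close> that] by simp
  have "(N < critical_mass a q \<alpha> n 1 \<longrightarrow> sobolev_zero a q \<alpha> N n n < 1) \<and>
      (N = critical_mass a q \<alpha> n 1 \<longrightarrow> sobolev_zero a q \<alpha> N n n = 1) \<and>
      (N > critical_mass a q \<alpha> n 1 \<longrightarrow> sobolev_zero a q \<alpha> N n n > 1)" if "N \<ge> 0" for N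
    using compare_of_sgn_eq[OF sgn[OF that]] by auto
  then show "let N0 = critical_mass a q \<alpha> n 1 in
             N0 > 0 \<and>
             (\<forall>N\<ge>0.
               (N < N0 \<longrightarrow> sobolev_zero a q \<alpha> N n n < 1) \<and>
               (N = N0 \<longrightarrow> sobolev_zero a q \<alpha> N n n = 1) \<and>
               (N > N0 \<longrightarrow> sobolev_zero a q \<alpha> N n n > 1))"
    using critical_mass_pos[OF \<open>n \<ge> 2\<close>] by (simp only: Let_def) blast
qed

end
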